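(* Let $\Bbbk$ be a field of characteristic zero, $X$ a finite set, and $\Sigma=(X,W,f)$ a terminating rewriting system on $\Bbbk\langle X\rangle$. Suppose that $(T(V),d)$ is a word-homogeneous acyclic extension of finite type of the Shafarevich complex $\mathrm{Sha}(W,\Bbbk\langle X\rangle)$. Then the rewriting system $\Sigma$ is convergent if and only if there exists a degree $-1$ element $F\in\mathrm{Der}(T(V))$ such that (1) for each basis element $e_w\in V_1$ ($w\in W$), we have $F(e_w)=-f(w)$; (2) $F|_{V_2}$ is $\Sigma$-filtered; (3) the Maurer--Cartan equation $[d,F]+\frac12[F,F]=0$ (equivalently, $[d+F,d+F]=0$) for the element $F$ holds when evaluated on generators of homological degree at most two, that is, on $V_0\oplus V_1\oplus V_2$.
   Context: **Rewriting.** $\langle X\rangle$ is the free monoid on $X$ (its elements are called monomials) and $\Bbbk\langle X\rangle$, its linear span, is the free unital associative algebra. For $g\in\Bbbk\langle X\rangle$, $\mathrm{supp}(g)$ is the set of monomials occurring in $g$ with non-zero coefficient. A rewriting system is a triple $\Sigma=(X,W,f)$ with $W\subset\langle X\rangle$ and $f\colon W\to\Bbbk\langle X\rangle$ a function. Put $R=\{w-f(w):w\in W\}$, $A_\Sigma=\Bbbk\langle X\rangle/(R)$ and $A_{\Sigma_0}=\Bbbk\langle X\rangle/(W)$. For $w\in W$, $a,b\in\langle X\rangle$, the basic reduction associated to $(a,w,b)$ is the linear endomorphism $\rho$ of $\Bbbk\langle X\rangle$ with $\rho(awb)=af(w)b$ and $\rho(m)=m$ for all other monomials $m$. An element $g$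 is irreducible if $\rho(g)=g$ for every basic reduction $\rho$. A normal form of $g$ is an irreducible element $\bar g$ with the same coset as $g$ in $A_\Sigma$. $\Sigma$ is terminating if for every $g$ and every infinite sequence $\rho_1,\rho_2,\ldots$ of basic reductions the sequence $\rho_1(g),\rho_2\rho_1(g),\rho_3\rho_2\rho_1(g),\ldots$ is eventually constant. Let $<_\Sigma$ be the smallest transitive relation on $\langle X\rangle$ such that $w'<_\Sigma w$ for all $w\in W$, $w'\in\mathrm{supp}(f(w))$, and such that $m<_\Sigma m'$ implies $amb<_\Sigma am'b$ for all $a,b\in\langle X\rangle$. Termination is identified with the property that $<_\Sigma$ is well-founded (every non-empty set of monomials has a $<_\Sigma$-minimal element; in particular $<_\Sigma$ is irreflexive), and this property is part of the standing assumption. A terminating $\Sigma$ is convergent if each $g\in\Bbbk\langle X\rangle$ has exactly one normal form. **Models.** Differential graded (dg) algebras are homologically graded with differential of degree $-1$ that is a graded derivation (Koszul sign rule). A quasi-free algebra is a dg algebra whose underlying graded algebra is a tensor algebra $T(V)$ on a graded vector space $V$; it is triangulated if there is a decomposition into graded subspaces $V=\bigoplus_{j\ge1}V^{(j)}$ such that for all $j\ge0$ the differential of each $v\in V^{(j+1)}$ lies in the subalgebra generated by $\bigoplus_{1\le k\le j}V^{(k)}$. A model of a dg algebra $A$ is a triangulated quasi-free algebra with a surjective quasi-isomorphism of dg algebras onto $A$; ordinary algebras are viewed as dg algebras concentrated in degree $0$ with zero differential. The Shafarevich complex $\mathrm{Sha}(W,\Bbbk\langle X\rangle)$ is the dg algebra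 $(T(V),d)$ with $V=V_0\oplus V_1$, $V_0=\Bbbk X$, $V_1$ having basis $\{e_w\}_{w\in W}$, and $d$ the derivation with $d(x)=0$ for $x\in X$ and $d(e_w)=w$. An acyclic extension of $\mathrm{Sha}(W,\Bbbk\langle X\rangle)$ is a model $(T(V),d)$ of $A_{\Sigma_0}=\Bbbk\langle X\rangle/(W)$ that is concentrated in non-negative homological degrees and in homological degrees zero and one is isomorphic to $\mathrm{Sha}(W,\Bbbk\langle X\rangle)$; so $V_0\cong\Bbbk X$, $V_1$ has basis $\{e_w\}_{w\in W}$, and $d(e_w)=w$. It is of finite type if $\dim V_n<\infty$ for all $n\ge0$. A dg algebra $(B,d)$ is word-homogeneous if $B=\bigoplus_{u\in\langle X\rangle}B_u$ as a direct sum of subcomplexes with $B_{u_1}B_{u_2}\subseteq B_{u_1u_2}$; elements of $B_u$ are word-homogeneous of grade $u$. The algebra $A_{\Sigma_0}$ is word-homogeneous in the obvious way. For a word-homogeneous acyclic extension $(T(V),d)$ of $\mathrm{Sha}(W,\Bbbk\langle X\rangle)$, the grading on $T(V)$ is induced from a grading by $\langle X\rangle$ on $V$, with each $x\in X$ of grade $x$ and each $e_w$ of grade $w$, and the map to $A_{\Sigma_0}$ preserves grades. A linear map defined on a graded (by $\langle X\rangle$) subspace of a word-homogeneous algebra, with values in that algebra, is $\Sigma$-filtered if it sends every element of grade $u$ to a linear combination of elements of grades strictly less than $u$ with respect to $<_\Sigma$. **Derivations.** $\mathrm{Der}(T(V))$ is the graded Lie algebra of all graded derivations of the graded algebra $T(V)$,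 with bracket $[D_1,D_2]=D_1D_2-(-1)^{|D_1||D_2|}D_2D_1$; with the differential $[d,-]$ it is a dg Lie algebra. For $F$ of degree $-1$ one has $\frac12[d+F,d+F]=(d+F)^2$. *)

theory Defs
  imports "HOL-Library.Poly_Mapping" "HOL-Algebra.QuotRing" "HOL-Algebra.Module"
begin

section \<open>Free algebras\<close>

text \<open>With concatenation as addition, the monoid algebra \<^typ>\<open>'s list \<Rightarrow>\<^sub>0 'k\<close> carries the
  (noncommutative) convolution product of \<^theory>\<open>HOL-Library.Poly_Mapping\<close>; this is the free
  unital associative algebra.\<close>

instantiation list :: (type) monoid_add
begin
definition zero_list :: "'a list" where "zero_list = []"
definition plus_list :: "'a list \<Rightarrow> 'a list \<Rightarrow> 'a list" where "plus_list xs ys = xs @ ys"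
instance by standard (simp_all add: zero_list_def plus_list_def)
end

definition mono_of :: "'s list \<Rightarrow> ('s list \<Rightarrow>\<^sub>0 'k::field)" where
  "mono_of m = Poly_Mapping.single m 1"

definition scale :: "'k::field \<Rightarrow> ('m \<Rightarrow>\<^sub>0 'k) \<Rightarrow> ('m \<Rightarrow>\<^sub>0 'k)" where
  "scale c = Poly_Mapping.map ((*) c)"

definition free_alg :: "'s set \<Rightarrow> ('k::field, 's list \<Rightarrow>\<^sub>0 'k) module" where
  "free_alg S = \<lparr>carrier = {p. Poly_Mapping.keys p \<subseteq> lists S}, mult = (*), one = 1,
     zero = 0, add = (+), smult = scale\<rparr>"

definition lin_ext :: "('m \<Rightarrow> ('n \<Rightarrow>\<^sub>0 'k)) \<Rightarrow> ('m \<Rightarrow>\<^sub>0 'k) \<Rightarrow> ('n \<Rightarrow>\<^sub>0 'k::field)" where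
  "lin_ext \<phi> p = (\<Sum>m\<in>Poly_Mapping.keys p. scale (Poly_Mapping.lookup p m) (\<phi> m))"

text \<open>The algebra homomorphism induced by a map of generators.\<close>

definition rename_gens :: "('s \<Rightarrow> 't) \<Rightarrow> ('s list \<Rightarrow>\<^sub>0 'k) \<Rightarrow> ('t list \<Rightarrow>\<^sub>0 'k::field)" where
  "rename_gens h = lin_ext (\<lambda>m. mono_of (map h m))"


section \<open>Linear algebra over the ground field\<close>

text \<open>The ground field is a type; this is the same field as an algebraic structure on all of its
  type, so that modules of \<^theory>\<open>HOL-Algebra.Module\<close> can be used.\<close>

definition scalars :: "'k::field ring" where
  "scalars = \<lparr>carrier = UNIV, mult = (*), one = 1, zero = 0, add = (+)\<rparr>"

locale assoc_algebra = module + ring M +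
  assumes smult_mult_left: "\<lbrakk>a \<in> carrier R; x \<in> carrier M; y \<in> carrier M\<rbrakk> \<Longrightarrow>
      (a \<odot>\<^bsub>M\<^esub> x) \<otimes>\<^bsub>M\<^esub> y = a \<odot>\<^bsub>M\<^esub> (x \<otimes>\<^bsub>M\<^esub> y)"
    and smult_mult_right: "\<lbrakk>a \<in> carrier R; x \<in> carrier M; y \<in> carrier M\<rbrakk> \<Longrightarrow>
      x \<otimes>\<^bsub>M\<^esub> (a \<odot>\<^bsub>M\<^esub> y) = a \<odot>\<^bsub>M\<^esub> (x \<otimes>\<^bsub>M\<^esub> y)"

definition lin_map ::
  "('k::field, 'a, 'm) module_scheme \<Rightarrow> ('k, 'b, 'n) module_scheme \<Rightarrow> ('a \<Rightarrow> 'b) \<Rightarrow> bool" where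
  "lin_map A B \<phi> \<longleftrightarrow> \<phi> \<in> carrier A \<rightarrow> carrier B \<and>
     (\<forall>x\<in>carrier A. \<forall>y\<in>carrier A. \<phi> (x \<oplus>\<^bsub>A\<^esub> y) = \<phi> x \<oplus>\<^bsub>B\<^esub> \<phi> y) \<and>
     (\<forall>c. \<forall>x\<in>carrier A. \<phi> (c \<odot>\<^bsub>A\<^esub> x) = c \<odot>\<^bsub>B\<^esub> \<phi> x)"

definition lin_span :: "('k::field, 'a, 'm) module_scheme \<Rightarrow> 'a set \<Rightarrow> 'a set" where
  "lin_span A S = \<Inter>{U. submodule U scalars A \<and> S \<subseteq> U}"

definition fin_dim :: "('k::field, 'a, 'm) module_scheme \<Rightarrow> 'a set \<Rightarrow> bool" where
  "fin_dim A U \<longleftrightarrow> (\<exists>S. finite S \<and> S \<subseteq> carrier A \<and> lin_span A S = U)"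

text \<open>\<open>U\<close> is the internal direct sum of the subspaces \<open>C i\<close>, \<open>i \<in> I\<close>; the family \<open>c\<close>
  consists of the components of \<open>x\<close>.\<close>

definition is_direct_sum ::
  "('k::field, 'a, 'm) module_scheme \<Rightarrow> 'a set \<Rightarrow> 'i set \<Rightarrow> ('i \<Rightarrow> 'a set) \<Rightarrow> bool" where
  "is_direct_sum A U I C \<longleftrightarrow> submodule U scalars A \<and>
     (\<forall>i\<in>I. submodule (C i) scalars A \<and> C i \<subseteq> U) \<and>
     (\<forall>x\<in>U. \<exists>!c. (\<forall>i\<in>I. c i \<in> C i) \<and> (\<forall>i. i \<notin> I \<longrightarrow> c i = \<zero>\<^bsub>A\<^esub>) \<and>
        finite {i. c i \<noteq> \<zero>\<^bsub>A\<^esub>} \<and> x = (\<Oplus>\<^bsub>A\<^esub>i\<in>{i. c i \<noteq> \<zero>\<^bsub>A\<^esub>}. c i))"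

definition subalg_gen :: "('k::field, 'a, 'm) module_scheme \<Rightarrow> 'a set \<Rightarrow> 'a set" where
  "subalg_gen A S = \<Inter>{B. submodule B scalars A \<and> \<one>\<^bsub>A\<^esub> \<in> B \<and>
     (\<forall>x\<in>B. \<forall>y\<in>B. x \<otimes>\<^bsub>A\<^esub> y \<in> B) \<and> S \<subseteq> B}"

text \<open>The quotient ring of \<^theory>\<open>HOL-Algebra.QuotRing\<close> with its scalar multiplication, defined on
  cosets in the same way as the product.\<close>

definition quot_alg :: "('k::field, 'a, 'm) module_scheme \<Rightarrow> 'a set \<Rightarrow> ('k, 'a set) module" where
  "quot_alg A I = ring.extend (A Quot I)
     (module.fields (\<lambda>c C. \<Union>x\<in>C. I +>\<^bsub>A\<^esub> (c \<odot>\<^bsub>A\<^esub> x)))"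


section \<open>Rewriting systems\<close>

definition rewriting_system ::
  "'x set \<Rightarrow> 'x list set \<Rightarrow> ('x list \<Rightarrow> ('x list \<Rightarrow>\<^sub>0 'k::field)) \<Rightarrow> bool" where
  "rewriting_system X W f \<longleftrightarrow> W \<subseteq> lists X \<and> f \<in> W \<rightarrow> carrier (free_alg X)"

definition relators :: "'x list set \<Rightarrow> ('x list \<Rightarrow> ('x list \<Rightarrow>\<^sub>0 'k::field)) \<Rightarrow> ('x list \<Rightarrow>\<^sub>0 'k) set" where
  "relators W f = {mono_of w - f w | w. w \<in> W}"

definition basic_reduction :: "('x list \<Rightarrow> ('x list \<Rightarrow>\<^sub>0 'k::field)) \<Rightarrow>
    'x list \<Rightarrow> 'x list \<Rightarrow> 'x list \<Rightarrow> ('x list \<Rightarrow>\<^sub>0 'k) \<Rightarrow> ('x list \<Rightarrow>\<^sub>0 'k)" where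
  "basic_reduction f a w b = lin_ext (\<lambda>m. if m = a @ w @ b then mono_of a * f w * mono_of b else mono_of m)"

definition basic_reductions :: "'x set \<Rightarrow> 'x list set \<Rightarrow> ('x list \<Rightarrow> ('x list \<Rightarrow>\<^sub>0 'k::field)) \<Rightarrow>
    (('x list \<Rightarrow>\<^sub>0 'k) \<Rightarrow> ('x list \<Rightarrow>\<^sub>0 'k)) set" where
  "basic_reductions X W f =
     {basic_reduction f a w b | a w b. a \<in> lists X \<and> w \<in> W \<and> b \<in> lists X}"

definition irreducible_elt :: "'x set \<Rightarrow> 'x list set \<Rightarrow> ('x list \<Rightarrow> ('x list \<Rightarrow>\<^sub>0 'k::field)) \<Rightarrow>
    ('x list \<Rightarrow>\<^sub>0 'k) \<Rightarrow> bool" where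
  "irreducible_elt X W f g \<longleftrightarrow> g \<in> carrier (free_alg X) \<and> (\<forall>\<rho>\<in>basic_reductions X W f. \<rho> g = g)"

text \<open>The second condition says that \<open>g\<close> and \<open>h\<close> have the same coset modulo the relators.\<close>

definition is_normal_form :: "'x set \<Rightarrow> 'x list set \<Rightarrow> ('x list \<Rightarrow> ('x list \<Rightarrow>\<^sub>0 'k::field)) \<Rightarrow>
    ('x list \<Rightarrow>\<^sub>0 'k) \<Rightarrow> ('x list \<Rightarrow>\<^sub>0 'k) \<Rightarrow> bool" where
  "is_normal_form X W f g h \<longleftrightarrow> irreducible_elt X W f h \<and>
     Idl\<^bsub>free_alg X\<^esub> (relators W f) +>\<^bsub>free_alg X\<^esub> h = Idl\<^bsub>free_alg X\<^esub> (relators W f) +>\<^bsub>free_alg X\<^esub> g"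

text \<open>\<open>rw_less X W f m' m\<close> is the relation \<open>m' < m\<close> induced by the rewriting system.\<close>

inductive rw_less :: "'x set \<Rightarrow> 'x list set \<Rightarrow> ('x list \<Rightarrow> ('x list \<Rightarrow>\<^sub>0 'k::field)) \<Rightarrow>
    'x list \<Rightarrow> 'x list \<Rightarrow> bool" for X W f where
  rw_rule: "\<lbrakk>w \<in> W; w' \<in> Poly_Mapping.keys (f w)\<rbrakk> \<Longrightarrow> rw_less X W f w' w"
| rw_trans: "\<lbrakk>rw_less X W f m m'; rw_less X W f m' m''\<rbrakk> \<Longrightarrow> rw_less X W f m m''"
| rw_context: "\<lbrakk>rw_less X W f m m'; a \<in> lists X; b \<in> lists X\<rbrakk> \<Longrightarrow> rw_less X W f (a @ m @ b) (a @ m' @ b)"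

text \<open>Termination comprises both the stabilisation of all sequences of basic reductions and the
  well-foundedness of the induced relation, the two being identified by convention. The relation
  lives on \<^term>\<open>lists X\<close>, so well-foundedness on the whole type is well-foundedness there.\<close>

definition terminating :: "'x set \<Rightarrow> 'x list set \<Rightarrow> ('x list \<Rightarrow> ('x list \<Rightarrow>\<^sub>0 'k::field)) \<Rightarrow> bool" where
  "terminating X W f \<longleftrightarrow>
     (\<forall>g\<in>carrier (free_alg X). \<forall>\<rho> :: nat \<Rightarrow> _. (\<forall>n. \<rho> n \<in> basic_reductions X W f) \<longrightarrow>
        (\<exists>N. \<forall>n\<ge>N. fold \<rho> [0..<n] g = fold \<rho> [0..<N] g)) \<and>
     wfp (rw_less X W f)"

definition convergent :: "'x set \<Rightarrow> 'x list set \<Rightarrow> ('x list \<Rightarrow> ('x list \<Rightarrow>\<^sub>0 'k::field)) \<Rightarrow> bool" where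
  "convergent X W f \<longleftrightarrow> terminating X W f \<and>
     (\<forall>g\<in>carrier (free_alg X). \<exists>!h. is_normal_form X W f g h)"


section \<open>Differential graded algebras\<close>

record ('k, 'a) dg_alg = "('k, 'a) module" +
  hpart :: "int \<Rightarrow> 'a set"
  dif :: "'a \<Rightarrow> 'a"

definition graded_derivation :: "('k::field, 'a, 'm) dg_alg_scheme \<Rightarrow> int \<Rightarrow> ('a \<Rightarrow> 'a) \<Rightarrow> bool" where
  "graded_derivation A k D \<longleftrightarrow> lin_map A A D \<and>
     (\<forall>n. D ` hpart A n \<subseteq> hpart A (n + k)) \<and>
     (\<forall>n. \<forall>x\<in>hpart A n. \<forall>y\<in>carrier A.
        D (x \<otimes>\<^bsub>A\<^esub> y) = D x \<otimes>\<^bsub>A\<^esub> y \<oplus>\<^bsub>A\<^esub> ((-1) powi (k * n)) \<odot>\<^bsub>A\<^esub> (x \<otimes>\<^bsub>A\<^esub> D y))"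

definition dg_algebra :: "('k::field, 'a, 'm) dg_alg_scheme \<Rightarrow> bool" where
  "dg_algebra A \<longleftrightarrow> assoc_algebra scalars A \<and>
     is_direct_sum A (carrier A) UNIV (hpart A) \<and>
     \<one>\<^bsub>A\<^esub> \<in> hpart A 0 \<and>
     (\<forall>m n. \<forall>x\<in>hpart A m. \<forall>y\<in>hpart A n. x \<otimes>\<^bsub>A\<^esub> y \<in> hpart A (m + n)) \<and>
     graded_derivation A (-1) (dif A) \<and>
     (\<forall>x\<in>carrier A. dif A (dif A x) = \<zero>\<^bsub>A\<^esub>)"

text \<open>The bracket of two derivations of degrees \<open>p\<close> and \<open>q\<close>.\<close>

definition der_bracket :: "('k::field, 'a, 'm) dg_alg_scheme \<Rightarrow> int \<Rightarrow> int \<Rightarrow>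
    ('a \<Rightarrow> 'a) \<Rightarrow> ('a \<Rightarrow> 'a) \<Rightarrow> 'a \<Rightarrow> 'a" where
  "der_bracket A p q D E x = D (E x) \<ominus>\<^bsub>A\<^esub> ((-1) powi (p * q)) \<odot>\<^bsub>A\<^esub> E (D x)"

definition dg_hom :: "('k::field, 'a, 'm) dg_alg_scheme \<Rightarrow> ('k, 'b, 'n) dg_alg_scheme \<Rightarrow>
    ('a \<Rightarrow> 'b) \<Rightarrow> bool" where
  "dg_hom A B \<phi> \<longleftrightarrow> \<phi> \<in> ring_hom A B \<and> lin_map A B \<phi> \<and>
     (\<forall>n. \<phi> ` hpart A n \<subseteq> hpart B n) \<and> (\<forall>x\<in>carrier A. \<phi> (dif A x) = dif B (\<phi> x))"

text \<open>Homology is the quotient of the additive group of cycles by the boundaries; the group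
  operation is written multiplicatively in \<^theory>\<open>HOL-Algebra.Group\<close>.\<close>

definition cycle_group :: "('k::field, 'a, 'm) dg_alg_scheme \<Rightarrow> int \<Rightarrow> 'a monoid" where
  "cycle_group A n =
     \<lparr>carrier = {x \<in> hpart A n. dif A x = \<zero>\<^bsub>A\<^esub>}, mult = add A, one = \<zero>\<^bsub>A\<^esub>\<rparr>"

definition boundaries :: "('k::field, 'a, 'm) dg_alg_scheme \<Rightarrow> int \<Rightarrow> 'a set" where
  "boundaries A n = dif A ` hpart A (n + 1)"

definition homology :: "('k::field, 'a, 'm) dg_alg_scheme \<Rightarrow> int \<Rightarrow> 'a set monoid" where
  "homology A n = cycle_group A n Mod boundaries A n"

definition homology_map :: "('k::field, 'b, 'n) dg_alg_scheme \<Rightarrow> int \<Rightarrow> ('a \<Rightarrow> 'b) \<Rightarrow>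
    'a set \<Rightarrow> 'b set" where
  "homology_map B n \<phi> C = (\<Union>x\<in>C. boundaries B n #>\<^bsub>cycle_group B n\<^esub> \<phi> x)"

definition quasi_iso :: "('k::field, 'a, 'm) dg_alg_scheme \<Rightarrow> ('k, 'b, 'n) dg_alg_scheme \<Rightarrow>
    ('a \<Rightarrow> 'b) \<Rightarrow> bool" where
  "quasi_iso A B \<phi> \<longleftrightarrow> dg_hom A B \<phi> \<and> (\<forall>n. homology_map B n \<phi> \<in> iso (homology A n) (homology B n))"

definition conc_zero :: "('k::field, 'a) module \<Rightarrow> ('k, 'a) dg_alg" where
  "conc_zero A = module.extend A
     (dg_alg.fields (\<lambda>n. if n = 0 then carrier A else {\<zero>\<^bsub>A\<^esub>}) (\<lambda>_. \<zero>\<^bsub>A\<^esub>))"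


section \<open>Quasi-free algebras and models\<close>

text \<open>A graded vector space \<open>V\<close> is given by a homogeneous basis \<open>G\<close> with degrees \<open>deg\<close> (over a
  field this is no restriction), so that \<open>T(V)\<close> is the free algebra on \<open>G\<close>, a monomial having as
  degree the sum of the degrees of its letters. Inside \<open>T(V)\<close>, the space spanned by a set \<open>S\<close> of
  generators is \<open>gen_space S\<close>.\<close>

definition quasi_free :: "'g set \<Rightarrow> ('g \<Rightarrow> int) \<Rightarrow>
    (('g list \<Rightarrow>\<^sub>0 'k::field) \<Rightarrow> ('g list \<Rightarrow>\<^sub>0 'k)) \<Rightarrow> ('k, 'g list \<Rightarrow>\<^sub>0 'k) dg_alg" where
  "quasi_free G deg d = module.extend (free_alg G)
     (dg_alg.fields
       (\<lambda>n. {p \<in> carrier (free_alg G). \<forall>m\<in>Poly_Mapping.keys p. sum_list (map deg m) = n}) d)"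

definition gen_space :: "'g set \<Rightarrow> ('g list \<Rightarrow>\<^sub>0 'k::field) set" where
  "gen_space S = {p. Poly_Mapping.keys p \<subseteq> (\<lambda>g. [g]) ` S}"

text \<open>The pieces \<open>Vs j\<close> need not be spanned by elements of the chosen basis, only be graded.\<close>

definition triangulated :: "'g set \<Rightarrow> ('g \<Rightarrow> int) \<Rightarrow>
    (('g list \<Rightarrow>\<^sub>0 'k::field) \<Rightarrow> ('g list \<Rightarrow>\<^sub>0 'k)) \<Rightarrow> bool" where
  "triangulated G deg d \<longleftrightarrow> (\<exists>Vs :: nat \<Rightarrow> _ set.
     is_direct_sum (quasi_free G deg d) (gen_space G) {1..} Vs \<and>
     (\<forall>j\<ge>1. is_direct_sum (quasi_free G deg d) (Vs j) UNIV (\<lambda>n. Vs j \<inter> hpart (quasi_free G deg d) n)) \<and>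
     (\<forall>j. \<forall>v\<in>Vs (Suc j). d v \<in> subalg_gen (quasi_free G deg d) (\<Union>k\<in>{1..j}. Vs k)))"

definition is_model :: "'g set \<Rightarrow> ('g \<Rightarrow> int) \<Rightarrow> (('g list \<Rightarrow>\<^sub>0 'k::field) \<Rightarrow> ('g list \<Rightarrow>\<^sub>0 'k)) \<Rightarrow>
    ('k, 'a, 'm) dg_alg_scheme \<Rightarrow> (('g list \<Rightarrow>\<^sub>0 'k) \<Rightarrow> 'a) \<Rightarrow> bool" where
  "is_model G deg d A \<phi> \<longleftrightarrow> dg_algebra (quasi_free G deg d) \<and> triangulated G deg d \<and>
     quasi_iso (quasi_free G deg d) A \<phi> \<and> \<phi> ` carrier (quasi_free G deg d) = carrier A"

definition finite_type :: "'g set \<Rightarrow> ('g \<Rightarrow> int) \<Rightarrow>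
    (('g list \<Rightarrow>\<^sub>0 'k::field) \<Rightarrow> ('g list \<Rightarrow>\<^sub>0 'k)) \<Rightarrow> bool" where
  "finite_type G deg d \<longleftrightarrow>
     (\<forall>n\<ge>0. fin_dim (quasi_free G deg d) (gen_space {g \<in> G. deg g = n}))"


section \<open>The Shafarevich complex and its acyclic extensions\<close>

text \<open>The graded derivation of degree \<open>k\<close> with prescribed values \<open>\<delta>\<close> on the generators, given by the
  Leibniz rule with Koszul signs.\<close>

definition derivation_ext :: "('g \<Rightarrow> int) \<Rightarrow> int \<Rightarrow> ('g \<Rightarrow> ('g list \<Rightarrow>\<^sub>0 'k::field)) \<Rightarrow>
    ('g list \<Rightarrow>\<^sub>0 'k) \<Rightarrow> ('g list \<Rightarrow>\<^sub>0 'k)" where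
  "derivation_ext deg k \<delta> = lin_ext (\<lambda>m. \<Sum>i<length m.
     scale ((-1) powi (k * sum_list (map deg (take i m))))
       (mono_of (take i m) * \<delta> (m ! i) * mono_of (drop (Suc i) m)))"

datatype 'x sha_gen = Var 'x | Rel "'x list"

definition sha_gens :: "'x set \<Rightarrow> 'x list set \<Rightarrow> 'x sha_gen set" where
  "sha_gens X W = Var ` X \<union> Rel ` W"

primrec sha_deg :: "'x sha_gen \<Rightarrow> int" where
  "sha_deg (Var x) = 0"
| "sha_deg (Rel w) = 1"

primrec sha_d :: "'x sha_gen \<Rightarrow> ('x sha_gen list \<Rightarrow>\<^sub>0 'k::field)" where
  "sha_d (Var x) = 0"
| "sha_d (Rel w) = mono_of (map Var w)"

definition shafarevich :: "'x set \<Rightarrow> 'x list set \<Rightarrow> ('k::field, 'x sha_gen list \<Rightarrow>\<^sub>0 'k) dg_alg" where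
  "shafarevich X W = quasi_free (sha_gens X W) sha_deg (derivation_ext sha_deg (-1) sha_d)"

definition mono_ideal :: "'x set \<Rightarrow> 'x list set \<Rightarrow> ('x list \<Rightarrow>\<^sub>0 'k::field) set" where
  "mono_ideal X W = Idl\<^bsub>free_alg X\<^esub> (mono_of ` W)"

definition mono_alg :: "'x set \<Rightarrow> 'x list set \<Rightarrow> ('k::field, ('x list \<Rightarrow>\<^sub>0 'k) set) dg_alg" where
  "mono_alg X W = conc_zero (quot_alg (free_alg X) (mono_ideal X W))"

text \<open>The map \<open>\<iota>\<close> identifies the generators of the Shafarevich complex with those generators of
  \<open>T(V)\<close> that have degree zero or one, compatibly with degrees and differentials: \<open>\<iota> (Var x)\<close> is \<open>x\<close>
  and \<open>\<iota> (Rel w)\<close> is the basis element \<open>e\<^sub>w\<close>.\<close>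

definition acyclic_extension :: "'x set \<Rightarrow> 'x list set \<Rightarrow> 'g set \<Rightarrow> ('g \<Rightarrow> int) \<Rightarrow>
    (('g list \<Rightarrow>\<^sub>0 'k::field) \<Rightarrow> ('g list \<Rightarrow>\<^sub>0 'k)) \<Rightarrow> ('x sha_gen \<Rightarrow> 'g) \<Rightarrow>
    (('g list \<Rightarrow>\<^sub>0 'k) \<Rightarrow> ('x list \<Rightarrow>\<^sub>0 'k) set) \<Rightarrow> bool" where
  "acyclic_extension X W G deg d \<iota> \<phi> \<longleftrightarrow>
     is_model G deg d (mono_alg X W) \<phi> \<and>
     (\<forall>n<0. hpart (quasi_free G deg d) n = {0}) \<and>
     bij_betw \<iota> (sha_gens X W) {g \<in> G. deg g \<in> {0, 1}} \<and>
     (\<forall>s\<in>sha_gens X W. deg (\<iota> s) = sha_deg s \<and>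
        d (mono_of [\<iota> s]) = rename_gens \<iota> (dif (shafarevich X W) (mono_of [s])))"


section \<open>Word-homogeneity\<close>

definition subcomplex :: "('k::field, 'a, 'm) dg_alg_scheme \<Rightarrow> 'a set \<Rightarrow> bool" where
  "subcomplex A U \<longleftrightarrow> is_direct_sum A U UNIV (\<lambda>n. U \<inter> hpart A n) \<and> dif A ` U \<subseteq> U"

definition word_homogeneous :: "'x set \<Rightarrow> ('k::field, 'a, 'm) dg_alg_scheme \<Rightarrow>
    ('x list \<Rightarrow> 'a set) \<Rightarrow> bool" where
  "word_homogeneous X A gr \<longleftrightarrow> is_direct_sum A (carrier A) (lists X) gr \<and>
     (\<forall>u\<in>lists X. subcomplex A (gr u)) \<and>
     (\<forall>u\<in>lists X. \<forall>v\<in>lists X. \<forall>x\<in>gr u. \<forall>y\<in>gr v. x \<otimes>\<^bsub>A\<^esub> y \<in> gr (u @ v))"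

text \<open>The grading of the free algebra on \<open>G\<close> induced by grades \<open>wt\<close> of the generators, and the
  grading of the monomial algebra, whose piece of grade \<open>u\<close> is spanned by the coset of \<open>u\<close>.\<close>

definition word_part :: "'g set \<Rightarrow> ('g \<Rightarrow> 'x list) \<Rightarrow> 'x list \<Rightarrow> ('g list \<Rightarrow>\<^sub>0 'k::field) set" where
  "word_part G wt u =
     {p \<in> carrier (free_alg G). \<forall>m\<in>Poly_Mapping.keys p. concat (map wt m) = u}"

definition mono_word_part :: "'x set \<Rightarrow> 'x list set \<Rightarrow> 'x list \<Rightarrow> ('x list \<Rightarrow>\<^sub>0 'k::field) set set" where
  "mono_word_part X W u = range (\<lambda>c. mono_ideal X W +>\<^bsub>free_alg X\<^esub> scale c (mono_of u))"

definition word_hom_acyclic_extension :: "'x set \<Rightarrow> 'x list set \<Rightarrow> 'g set \<Rightarrow> ('g \<Rightarrow> int) \<Rightarrow>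
    ('g \<Rightarrow> 'x list) \<Rightarrow> (('g list \<Rightarrow>\<^sub>0 'k::field) \<Rightarrow> ('g list \<Rightarrow>\<^sub>0 'k)) \<Rightarrow> ('x sha_gen \<Rightarrow> 'g) \<Rightarrow>
    (('g list \<Rightarrow>\<^sub>0 'k) \<Rightarrow> ('x list \<Rightarrow>\<^sub>0 'k) set) \<Rightarrow> bool" where
  "word_hom_acyclic_extension X W G deg wt d \<iota> \<phi> \<longleftrightarrow>
     acyclic_extension X W G deg d \<iota> \<phi> \<and>
     word_homogeneous X (quasi_free G deg d) (word_part G wt) \<and>
     (\<forall>x\<in>X. wt (\<iota> (Var x)) = [x]) \<and> (\<forall>w\<in>W. wt (\<iota> (Rel w)) = w) \<and>
     (\<forall>u\<in>lists X. \<phi> ` word_part G wt u \<subseteq> mono_word_part X W u)"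

text \<open>\<open>U\<close> is the graded subspace on which the map is considered, and \<open>lt\<close> the relation on words.\<close>

definition filtered_on :: "'x set \<Rightarrow> ('x list \<Rightarrow> 'x list \<Rightarrow> bool) \<Rightarrow> ('k::field, 'a, 'm) module_scheme \<Rightarrow>
    ('x list \<Rightarrow> 'a set) \<Rightarrow> 'a set \<Rightarrow> ('a \<Rightarrow> 'a) \<Rightarrow> bool" where
  "filtered_on X lt A gr U F \<longleftrightarrow>
     (\<forall>u\<in>lists X. \<forall>v\<in>U \<inter> gr u. F v \<in> lin_span A (\<Union>u'\<in>{u'\<in>lists X. lt u' u}. gr u'))"

end

theory Submission
  imports Defs "HOL-Library.Multiset"
begin

text \<open>
  Write \<open>D = d + F\<close>. In degree one, \<open>D\<close> sends \<open>a e\<^sub>w b\<close> to \<open>a (w - f w) b\<close>, so the ideal of relations is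
  the image of \<open>D\<close> on degree one, and \<open>\<Sigma>\<close> is convergent iff this ideal contains no nonzero irreducible
  element. The Maurer--Cartan equation says that \<open>D\<^sup>2 = 0\<close> on degree two.

  If \<open>F\<close> exists and \<open>g = D z\<close> is irreducible, then the components of \<open>z\<close> of maximal grade are cycles of
  \<open>d\<close>, hence boundaries since \<open>H\<^sub>1(T(V)) = 0\<close>; as \<open>D\<^sup>2 = 0\<close>, they can be replaced by terms of smaller
  grade without changing \<open>D z\<close>. By well-foundedness this ends with \<open>z = 0\<close>. Conversely, if \<open>\<Sigma>\<close> is
  convergent, then for a generator \<open>v\<close> of degree two, \<open>F (d v)\<close> lies in the ideal of relations and
  therefore reduces to \<open>0\<close>; the reduction steps give \<open>z\<close> of smaller grade with \<open>D z = F (d v)\<close>, and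
  \<open>F v = - z\<close> works. On generators of higher degree \<open>F\<close> may be taken to be zero.
\<close>

section \<open>Linear algebra in free algebras\<close>

abbreviation supp :: "('a \<Rightarrow>\<^sub>0 'b::zero) \<Rightarrow> 'a set" where
  "supp \<equiv> Poly_Mapping.keys"

lemma lookup_scale [simp]: "Poly_Mapping.lookup (scale c p) m = c * Poly_Mapping.lookup p m"
  unfolding scale_def by (simp add: Poly_Mapping.map.rep_eq when_def)

lemma scale_zero [simp]: "scale 0 p = 0" "scale c 0 = 0"
  and scale_one [simp]: "scale 1 p = p"
  and scale_scale [simp]: "scale c (scale c' p) = scale (c * c') p"
  and scale_add: "scale c (p + q) = scale c p + scale c q"
  and scale_add_left: "scale (c + c') p = scale c p + scale c' p"
  and scale_diff: "scale c (p - q) = scale c p - scale c q"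
  and scale_uminus [simp]: "scale c (- p) = - scale c p" "scale (- c) p = - scale c p"
  by (rule poly_mapping_eqI; simp add: lookup_add lookup_minus algebra_simps)+

lemma scale_sum: "scale c (\<Sum>i\<in>I. p i) = (\<Sum>i\<in>I. scale c (p i))"
  by (induction I rule: infinite_finite_induct) (simp_all add: scale_add)

lemma supp_scale: "supp (scale c p) \<subseteq> supp p"
  by (auto simp: in_keys_iff)

lemma supp_uminus [simp]: "supp (- (p :: 'm \<Rightarrow>\<^sub>0 'k::field)) = supp p"
  by (auto simp: in_keys_iff)

lemma supp_diff: "supp (p - (q :: 'm \<Rightarrow>\<^sub>0 'k::field)) \<subseteq> supp p \<union> supp q"
  by (auto simp: in_keys_iff lookup_minus)

lemma supp_sum: "supp (\<Sum>i\<in>I. p i) \<subseteq> (\<Union>i\<in>I. supp (p i))"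
  by (induction I rule: infinite_finite_induct) (use keys_add in \<open>fastforce+\<close>)

section \<open>Monomials as a basis of the free algebra\<close>

lemma mono_of_Nil [simp]: "mono_of [] = 1"
  by (simp add: mono_of_def flip: zero_list_def single_one)

lemma mono_of_append: "mono_of (m @ n) = mono_of m * mono_of n"
  by (simp add: mono_of_def mult_single plus_list_def)

lemma mono_of_Cons: "mono_of (g # m) = mono_of [g] * mono_of m"
  using mono_of_append[of "[g]" m] by simp

lemma supp_mono_of [simp]: "supp (mono_of m :: 's list \<Rightarrow>\<^sub>0 'k::field) = {m}"
  by (simp add: mono_of_def)

lemma lookup_mono_of: "Poly_Mapping.lookup (mono_of m) n = (if m = n then 1 else 0)"
  by (simp add: mono_of_def lookup_single when_def)

lemma supp_mult: "supp (p * q :: 's list \<Rightarrow>\<^sub>0 'k::field) \<subseteq> {m @ n | m n. m \<in> supp p \<and> n \<in> supp q}"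
  using keys_mult[of p q] by (auto simp: plus_list_def)

lemma sum_monomials: "(\<Sum>m\<in>supp p. scale (Poly_Mapping.lookup p m) (mono_of m)) = p"
  by (rule poly_mapping_eqI)
    (simp add: lookup_sum lookup_mono_of if_distrib in_keys_iff cong: if_cong)

text \<open>A property stable under linear combinations need only be checked on monomials. The
  support bounds in the \<open>add\<close> case allow \<open>P\<close> to involve maps that are
  additive only on elements supported in \<open>K\<close>.\<close>

lemma linear_induct [consumes 1, case_names zero add scale]:
  fixes p :: "'s list \<Rightarrow>\<^sub>0 'k::field"
  assumes "supp p \<subseteq> K" and "P 0"
    and "\<And>p q. supp p \<subseteq> K \<Longrightarrow> supp q \<subseteq> K \<Longrightarrow> P p \<Longrightarrow> P q \<Longrightarrow> P (p + q)"
    and "\<And>c m. m \<in> K \<Longrightarrow> P (scale c (mono_of m))"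
  shows "P p"
proof -
  have "supp (\<Sum>m\<in>I. scale (Poly_Mapping.lookup p m) (mono_of m)) \<subseteq> K
      \<and> P (\<Sum>m\<in>I. scale (Poly_Mapping.lookup p m) (mono_of m))" if "finite I" "I \<subseteq> K" for I
    using that
  proof (induction I)
    case empty
    show ?case using assms(2) by simp
  next
    case (insert m I)
    have "supp (scale (Poly_Mapping.lookup p m) (mono_of m) :: 's list \<Rightarrow>\<^sub>0 'k) \<subseteq> K"
      using supp_scale[of _ "mono_of m :: 's list \<Rightarrow>\<^sub>0 'k"] insert.prems by fastforce
    with insert show ?case
      by (auto intro!: assms(3,4) dest!: subsetD[OF keys_add])
  qed
  from this[of "supp p"] show ?thesis using assms(1) by (simp add: sum_monomials)
qed

text \<open>Scaling by \<open>c\<close> is multiplication by the constant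
  \<open>Poly_Mapping.single 0 c\<close>, which is central because it commutes with every monomial.
  Both rules are then instances of associativity.\<close>

lemma scale_mult:
  fixes p q :: "'s list \<Rightarrow>\<^sub>0 'k::field"
  shows "scale c p * q = scale c (p * q)"
    and "p * scale c q = scale c (p * q)"
proof -
  have conv: "scale c p = Poly_Mapping.single 0 c * p" for p :: "'s list \<Rightarrow>\<^sub>0 'k"
    unfolding scale_def by (rule mult_map_scale_conv_mult)
  have comm: "p * Poly_Mapping.single 0 c = Poly_Mapping.single 0 c * p"
    for p :: "'s list \<Rightarrow>\<^sub>0 'k"
  proof -
    have "supp p \<subseteq> UNIV" by simp
    then show ?thesis
    proof (induction p rule: linear_induct)
      case (scale c' m)
      have "scale c' (mono_of m) = (Poly_Mapping.single m c' :: 's list \<Rightarrow>\<^sub>0 'k)"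
        by (rule poly_mapping_eqI) (simp add: lookup_mono_of lookup_single when_def)
      then show ?case by (simp add: mult_single mult.commute)
    qed (simp_all add: algebra_simps)
  qed
  show "scale c p * q = scale c (p * q)" "p * scale c q = scale c (p * q)"
    unfolding conv by (simp_all add: mult.assoc flip: comm)
qed

section \<open>Linear extension from monomials, and the algebra homomorphisms it induces\<close>

lemma lin_ext_superset:
  assumes "finite K" "supp p \<subseteq> K"
  shows "lin_ext h p = (\<Sum>m\<in>K. scale (Poly_Mapping.lookup p m) (h m))"
  unfolding lin_ext_def using assms by (intro sum.mono_neutral_left) (auto simp: in_keys_iff)

lemma lin_ext_add: "lin_ext h (p + q) = lin_ext h p + lin_ext h q"
proof -
  let ?K = "supp p \<union> supp q"
  show ?thesis
    using keys_add[of p q]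
    by (simp add: lin_ext_superset[of ?K] lookup_add scale_add_left sum.distrib)
qed

lemma lin_ext_scale: "lin_ext h (scale c p) = scale c (lin_ext h p)"
  using supp_scale[of c p]
  by (simp add: lin_ext_superset[of "supp p"] scale_sum)

lemma lin_ext_zero [simp]: "lin_ext h 0 = 0"
  by (simp add: lin_ext_def)

lemma lin_ext_uminus: "lin_ext h (- p) = - lin_ext h p"
  using lin_ext_scale[of h "-1" p] by simp

lemma lin_ext_diff: "lin_ext h (p - q) = lin_ext h p - lin_ext h q"
  using lin_ext_add[of h p "- q"] by (simp add: lin_ext_uminus)

lemma lin_ext_mono_of [simp]: "lin_ext h (mono_of m :: 's list \<Rightarrow>\<^sub>0 'k::field) = h m"
  by (simp add: lin_ext_def lookup_mono_of)

lemma lin_ext_cong: "(\<And>m. m \<in> supp p \<Longrightarrow> h m = h' m) \<Longrightarrow> lin_ext h p = lin_ext h' p"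
  by (simp add: lin_ext_def)

lemma supp_lin_ext: "supp (lin_ext h p) \<subseteq> (\<Union>m\<in>supp p. supp (h m))"
  unfolding lin_ext_def using supp_sum supp_scale by fastforce

text \<open>By bilinearity the claim reduces to monomials, where it is multiplicativity of
  \<open>h\<close>. It serves both the renaming of generators and the passage from a monomial of
  \<open>T(V)\<close> to its grade.\<close>

lemma lin_ext_mono_mult:
  fixes p q :: "'s list \<Rightarrow>\<^sub>0 'k::field"
  assumes "\<And>m n. h (m @ n) = h m @ h n"
  shows "lin_ext (\<lambda>m. mono_of (h m)) (p * q)
    = lin_ext (\<lambda>m. mono_of (h m)) p * lin_ext (\<lambda>m. mono_of (h m)) q"
    (is "?h (p * q) = ?h p * ?h q")
proof -
  have "supp p \<subseteq> UNIV" by simp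
  then show ?thesis
  proof (induction p rule: linear_induct)
    case (scale c m)
    have "supp q \<subseteq> UNIV" by simp
    then show ?case
    proof (induction q rule: linear_induct)
      case (scale c' n)
      have "?h (mono_of m * mono_of n) = mono_of (h m) * mono_of (h n)"
        by (simp add: assms flip: mono_of_append)
      then show ?case by (simp add: scale_mult lin_ext_scale)
    qed (simp_all add: lin_ext_add distrib_left)
  qed (simp_all add: lin_ext_add distrib_right)
qed

lemma rename_gens_mult: "rename_gens h (p * q) = rename_gens h p * rename_gens h q"
  unfolding rename_gens_def by (rule lin_ext_mono_mult) simp

lemma rename_gens_mono_of [simp]:
  "rename_gens h (mono_of m) = (mono_of (map h m) :: 't list \<Rightarrow>\<^sub>0 'k::field)"
  by (simp add: rename_gens_def)

lemma supp_rename_gens: "supp (rename_gens h p) \<subseteq> map h ` supp p"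
  unfolding rename_gens_def using supp_lin_ext by fastforce

section \<open>Free and quasi-free algebras as algebraic structures\<close>

lemma free_alg_simps [simp]:
  "carrier (free_alg S) = {p. supp p \<subseteq> lists S}" "monoid.mult (free_alg S) = (*)" "one (free_alg S) = 1"
  "zero (free_alg S) = 0" "add (free_alg S) = (+)" "smult (free_alg S) = scale"
  by (simp_all add: free_alg_def)

lemma supp_add_subset: "supp p \<subseteq> K \<Longrightarrow> supp q \<subseteq> K \<Longrightarrow> supp (p + q) \<subseteq> K"
  using keys_add[of p q] by blast

lemma supp_diff_subset:
  "supp p \<subseteq> K \<Longrightarrow> supp q \<subseteq> K \<Longrightarrow> supp (p - (q :: 'm \<Rightarrow>\<^sub>0 'k::field)) \<subseteq> K"
  using supp_diff[of p q] by blast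

lemma supp_scale_subset: "supp p \<subseteq> K \<Longrightarrow> supp (scale c p) \<subseteq> K"
  using supp_scale[of c p] by blast

lemma supp_mult_lists:
  "supp p \<subseteq> lists S \<Longrightarrow> supp q \<subseteq> lists S \<Longrightarrow> supp (p * q :: 's list \<Rightarrow>\<^sub>0 'k::field) \<subseteq> lists S"
  using supp_mult[of p q] by fastforce

lemma ring_free_alg: "ring (free_alg S :: ('k::field, 's list \<Rightarrow>\<^sub>0 'k) module)"
proof (rule ringI)
  show "abelian_group (free_alg S :: ('k, 's list \<Rightarrow>\<^sub>0 'k) module)"
  proof (rule abelian_groupI)
    fix p :: "'s list \<Rightarrow>\<^sub>0 'k" assume "p \<in> carrier (free_alg S)"
    then show "\<exists>q\<in>carrier (free_alg S). q \<oplus>\<^bsub>free_alg S\<^esub> p = \<zero>\<^bsub>free_alg S\<^esub>"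
      by (intro bexI[of _ "- p"]) auto
  qed (simp_all add: supp_add_subset algebra_simps)
  show "monoid (free_alg S :: ('k, 's list \<Rightarrow>\<^sub>0 'k) module)"
    by (rule monoidI) (simp_all add: supp_mult_lists mult.assoc zero_list_def)
qed (simp_all add: algebra_simps)

text \<open>A homogeneous part is rewritten as a single inclusion of supports, so that degree
  arguments become inclusions between sets of monomials.\<close>

lemma quasi_free_simps [simp]:
  "carrier (quasi_free G deg d) = {p. supp p \<subseteq> lists G}" "monoid.mult (quasi_free G deg d) = (*)"
  "one (quasi_free G deg d) = 1" "zero (quasi_free G deg d) = 0" "add (quasi_free G deg d) = (+)"
  "smult (quasi_free G deg d) = scale" "dif (quasi_free G deg d) = d"
  "hpart (quasi_free G deg d) n = {p. supp p \<subseteq> {m \<in> lists G. sum_list (map deg m) = n}}"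
  by (auto simp: quasi_free_def module.defs dg_alg.defs free_alg_def)

section \<open>Graded derivations of free algebras\<close>

abbreviation mons :: "'g set \<Rightarrow> ('g \<Rightarrow> int) \<Rightarrow> int \<Rightarrow> 'g list set" where
  "mons G deg n \<equiv> {m \<in> lists G. sum_list (map deg m) = n}"

lemma supp_mult_mons:
  assumes "supp p \<subseteq> mons G deg i" "supp q \<subseteq> mons G deg j" "i + j = k"
  shows "supp (p * q :: 'g list \<Rightarrow>\<^sub>0 'k::field) \<subseteq> mons G deg k"
  using supp_mult[of p q] assms by fastforce

lemma powi_minus_one_add: "(-1 :: 'k::field) powi (i + j) = (-1) powi i * (-1) powi j"
  by (simp add: power_int_add)

context
  fixes G :: "'g set" and deg :: "'g \<Rightarrow> int" and d D :: "('g list \<Rightarrow>\<^sub>0 'k::field) \<Rightarrow> 'g list \<Rightarrow>\<^sub>0 'k"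
    and k :: int
  assumes D: "graded_derivation (quasi_free G deg d) k D"
begin

lemma derivation_closed: "supp p \<subseteq> lists G \<Longrightarrow> supp (D p) \<subseteq> lists G"
  using D by (auto simp: graded_derivation_def lin_map_def Pi_iff)

lemma derivation_add: "supp p \<subseteq> lists G \<Longrightarrow> supp q \<subseteq> lists G \<Longrightarrow> D (p + q) = D p + D q"
  using D by (simp add: graded_derivation_def lin_map_def)

lemma derivation_scale: "supp p \<subseteq> lists G \<Longrightarrow> D (scale c p) = scale c (D p)"
  using D by (simp add: graded_derivation_def lin_map_def)

lemma derivation_zero: "D 0 = 0"
  using derivation_scale[of 0 0] by simp

lemma derivation_uminus: "supp p \<subseteq> lists G \<Longrightarrow> D (- p) = - D p"
  using derivation_scale[of p "-1"] by simp

lemma derivation_diff: "supp p \<subseteq> lists G \<Longrightarrow> supp q \<subseteq> lists G \<Longrightarrow> D (p - q) = D p - D q"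
  using derivation_add[of p "- q"] by (simp add: derivation_uminus)

text \<open>The target degree is a separate variable \<open>j\<close> tied by an equation, so that
  it can be given in whatever form a caller has.\<close>

lemma derivation_mons:
  assumes "supp p \<subseteq> mons G deg i" "i + k = j"
  shows "supp (D p) \<subseteq> mons G deg j"
proof -
  have "\<forall>n. D ` {p. supp p \<subseteq> mons G deg n} \<subseteq> {p. supp p \<subseteq> mons G deg (n + k)}"
    using D unfolding graded_derivation_def quasi_free_simps by (elim conjE)
  with assms show ?thesis by blast
qed

lemma derivation_mult:
  assumes "supp p \<subseteq> mons G deg i" "supp q \<subseteq> lists G"
  shows "D (p * q) = D p * q + scale ((-1) powi (k * i)) (p * D q)"
proof -
  have "\<forall>n. \<forall>p\<in>{p. supp p \<subseteq> mons G deg n}. \<forall>q\<in>{q. supp q \<subseteq> lists G}.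
      D (p * q) = D p * q + scale ((-1) powi (k * n)) (p * D q)"
    using D unfolding graded_derivation_def quasi_free_simps by (elim conjE)
  with assms show ?thesis by blast
qed

text \<open>The Leibniz rule for \<open>1 = 1 * 1\<close> gives
  \<open>D 1 = D 1 + D 1\<close>.\<close>

lemma derivation_one: "D 1 = 0"
  using derivation_mult[of 1 0 1] by (simp add: zero_list_def)

lemma derivation_Cons:
  assumes "g \<in> G" "m \<in> lists G"
  shows "D (mono_of (g # m)) = D (mono_of [g]) * mono_of m
    + scale ((-1) powi (k * deg g)) (mono_of [g] * D (mono_of m))"
  using assms by (subst mono_of_Cons) (rule derivation_mult, auto)

lemma derivation_eq_lin_ext:
  assumes "supp p \<subseteq> lists G"
  shows "D p = lin_ext (\<lambda>m. D (mono_of m)) p"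
  using assms
  by (induction p rule: linear_induct)
    (simp_all add: derivation_zero derivation_add derivation_scale lin_ext_add lin_ext_scale)

lemma supp_derivation:
  assumes "supp p \<subseteq> lists G"
  shows "supp (D p) \<subseteq> (\<Union>m\<in>supp p. supp (D (mono_of m)))"
  unfolding derivation_eq_lin_ext[OF assms] by (rule supp_lin_ext)

end

lemma graded_derivationI:
  assumes "\<And>p. supp p \<subseteq> lists G \<Longrightarrow> supp (D p) \<subseteq> lists G"
    and "\<And>p q. supp p \<subseteq> lists G \<Longrightarrow> supp q \<subseteq> lists G \<Longrightarrow> D (p + q) = D p + D q"
    and "\<And>p c. supp p \<subseteq> lists G \<Longrightarrow> D (scale c p) = scale c (D p)"
    and "\<And>p n. supp p \<subseteq> mons G deg n \<Longrightarrow> supp (D p) \<subseteq> mons G deg (n + k)"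
    and "\<And>p q n. supp p \<subseteq> mons G deg n \<Longrightarrow> supp q \<subseteq> lists G \<Longrightarrow>
      D (p * q) = D p * q + scale ((-1) powi (k * n)) (p * D q)"
  shows "graded_derivation (quasi_free G deg d) k D"
  unfolding graded_derivation_def lin_map_def quasi_free_simps
  using assms by (intro conjI allI ballI funcsetI image_subsetI) (simp_all only: mem_Collect_eq)

lemma graded_derivation_add:
  fixes D E :: "('g list \<Rightarrow>\<^sub>0 'k::field) \<Rightarrow> 'g list \<Rightarrow>\<^sub>0 'k"
  assumes "graded_derivation (quasi_free G deg d) k D" "graded_derivation (quasi_free G deg d) k E"
  shows "graded_derivation (quasi_free G deg d) k (\<lambda>p. D p + E p)"
proof (rule graded_derivationI)
  fix p q :: "'g list \<Rightarrow>\<^sub>0 'k" and n c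
  assume p: "supp p \<subseteq> lists G"
  show "D (scale c p) + E (scale c p) = scale c (D p + E p)"
    by (simp add: assms[THEN derivation_scale, OF p] scale_add)
  assume "supp q \<subseteq> lists G"
  with p show "D (p + q) + E (p + q) = D p + E p + (D q + E q)"
    by (simp add: assms[THEN derivation_add])
next
  fix p q :: "'g list \<Rightarrow>\<^sub>0 'k" and n
  assume p: "supp p \<subseteq> mons G deg n"
  show "supp (D p + E p) \<subseteq> mons G deg (n + k)"
    by (intro supp_add_subset assms[THEN derivation_mons, OF p refl])
  assume q: "supp q \<subseteq> lists G"
  show "D (p * q) + E (p * q) = (D p + E p) * q + scale ((-1) powi (k * n)) (p * (D q + E q))"
    by (simp add: assms[THEN derivation_mult, OF p q] scale_add distrib_left distrib_right)
qed (intro supp_add_subset assms[THEN derivation_closed])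

text \<open>The square of an odd derivation is again a derivation, so it vanishes on a word as soon
  as it vanishes on the letters. In the induction on the word only the two cross terms survive, and
  they cancel.\<close>

lemma derivation_square_zero:
  assumes D: "graded_derivation (quasi_free G deg d) (-1) D"
    and "m \<in> lists G" "\<And>g. g \<in> set m \<Longrightarrow> D (D (mono_of [g])) = 0"
  shows "D (D (mono_of m)) = 0"
  using assms(2,3)
proof (induction m)
  case Nil
  show ?case by (simp add: derivation_one[OF D] derivation_zero[OF D])
next
  case (Cons g m)
  let ?s = "(-1) powi (- deg g) :: 'b"
  have g: "g \<in> G" "m \<in> lists G" using Cons.hyps by auto
  have *: "supp (D (mono_of [g])) \<subseteq> mons G deg (deg g - 1)"
    using g by (intro derivation_mons[OF D, of _ "deg g"]) auto
  have m: "supp (D (mono_of m)) \<subseteq> lists G"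
    using g by (intro derivation_closed[OF D]) auto
  have "D (D (mono_of (g # m))) = D (D (mono_of [g]) * mono_of m) + scale ?s (D (mono_of [g] * D (mono_of m)))"
  proof -
    have 1: "supp (D (mono_of [g]) * mono_of m) \<subseteq> lists G"
      using * g by (intro supp_mult_lists) auto
    have 2: "supp (mono_of [g] * D (mono_of m)) \<subseteq> lists G"
      using g m by (intro supp_mult_lists) auto
    show ?thesis
      by (simp add: derivation_Cons[OF D g] derivation_add[OF D 1 supp_scale_subset[OF 2]]
          derivation_scale[OF D 2])
  qed
  also have "D (D (mono_of [g]) * mono_of m)
      = scale ((-1) powi (- (deg g - 1))) (D (mono_of [g]) * D (mono_of m))"
    using derivation_mult[OF D *, of "mono_of m"] g Cons.prems by simp
  also have "D (mono_of [g] * D (mono_of m)) = D (mono_of [g]) * D (mono_of m)"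
    using derivation_mult[OF D _ m, of "mono_of [g]" "deg g"] g Cons.IH Cons.prems by simp
  \<comment> \<open>Applying \<open>D\<close> lowers the degree of the left factor by one, so the
    two cross terms carry opposite signs.\<close>
  also have "(-1) powi (- (deg g - 1)) = - ?s"
    using powi_minus_one_add[of "- deg g" 1, where 'k = 'b] by (simp add: algebra_simps)
  finally show ?case by simp
qed

section \<open>Derivations with prescribed values on generators\<close>

context
  fixes deg :: "'g \<Rightarrow> int" and k :: int and \<delta> :: "'g \<Rightarrow> ('g list \<Rightarrow>\<^sub>0 'k::field)"
begin

lemma derivation_ext_gen: "derivation_ext deg k \<delta> (mono_of [g]) = \<delta> g"
  by (simp add: derivation_ext_def)

lemma derivation_ext_Nil: "derivation_ext deg k \<delta> 1 = 0"
  by (simp add: derivation_ext_def flip: mono_of_Nil)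

text \<open>The first term is the summand for \<open>i = 0\<close>; all later summands share the
  left factor \<open>g\<close> and its sign.\<close>

lemma derivation_ext_Cons:
  "derivation_ext deg k \<delta> (mono_of (g # m)) = \<delta> g * mono_of m
    + scale ((-1) powi (k * deg g)) (mono_of [g] * derivation_ext deg k \<delta> (mono_of m))"
  by (simp add: derivation_ext_def sum.lessThan_Suc_shift scale_sum sum_distrib_left scale_mult
      distrib_left powi_minus_one_add mult.assoc mono_of_Cons[of g "take _ m"] del: sum.lessThan_Suc)

lemma derivation_ext_append:
  "derivation_ext deg k \<delta> (mono_of (m @ n)) = derivation_ext deg k \<delta> (mono_of m) * mono_of n
    + scale ((-1) powi (k * sum_list (map deg m))) (mono_of m * derivation_ext deg k \<delta> (mono_of n))"
proof (induction m)
  case Nil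
  show ?case by (simp add: derivation_ext_Nil)
next
  case (Cons g m)
  show ?case
    unfolding append_Cons derivation_ext_Cons Cons.IH
    by (simp add: scale_mult distrib_left distrib_right scale_add powi_minus_one_add mult.assoc
        mono_of_append mono_of_Cons[of g m])
qed

text \<open>For words the Leibniz rule is \<open>derivation_ext_append\<close>, and it extends
  bilinearly to all elements. To construct a derivation it is therefore enough to choose values of
  the right degree on the generators.\<close>

lemma graded_derivation_ext:
  assumes \<delta>: "\<And>g. g \<in> G \<Longrightarrow> supp (\<delta> g) \<subseteq> mons G deg (deg g + k)"
  shows "graded_derivation (quasi_free G deg d) k (derivation_ext deg k \<delta>)"
proof -
  let ?D = "derivation_ext deg k \<delta>"
  have lin: "?D (p + q) = ?D p + ?D q" "?D (scale c p) = scale c (?D p)" for p q c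
    by (simp_all add: derivation_ext_def lin_ext_add lin_ext_scale)
  have mons: "supp (?D (mono_of m)) \<subseteq> mons G deg (sum_list (map deg m) + k)" if "m \<in> lists G" for m
    using that
  proof (induction m)
    case Nil
    show ?case by (simp add: derivation_ext_Nil)
  next
    case (Cons g m)
    have "supp (\<delta> g * mono_of m) \<subseteq> mons G deg (sum_list (map deg (g # m)) + k)"
      using Cons.hyps by (intro supp_mult_mons[OF \<delta>[OF Cons.hyps(1)], of _ "sum_list (map deg m)"]) auto
    moreover have "supp (mono_of [g] * ?D (mono_of m)) \<subseteq> mons G deg (sum_list (map deg (g # m)) + k)"
      using Cons.hyps by (intro supp_mult_mons[OF _ Cons.IH, of _ "deg g"]) auto
    ultimately show ?case
      by (simp only: derivation_ext_Cons) (intro supp_add_subset supp_scale_subset)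
  qed
  have supp: "supp (?D p) \<subseteq> (\<Union>m\<in>supp p. supp (?D (mono_of m)))" for p
    using supp_lin_ext[of "\<lambda>m. ?D (mono_of m)" p] by (simp add: derivation_ext_def)
  have mult: "?D (p * q) = ?D p * q + scale ((-1) powi (k * n)) (p * ?D q)"
    if "supp p \<subseteq> mons G deg n" for p q n
    using that
  proof (induction p rule: linear_induct)
    case (scale c m)
    have "supp q \<subseteq> UNIV" by simp
    then show ?case
    proof (induction q rule: linear_induct)
      case (scale c' m')
      have "?D (mono_of m * mono_of m')
          = ?D (mono_of m) * mono_of m' + scale ((-1) powi (k * n)) (mono_of m * ?D (mono_of m'))"
        using derivation_ext_append[of m m'] \<open>m \<in> mons G deg n\<close> by (simp add: mono_of_append)
      then show ?case
        by (simp only: scale_mult lin scale_add scale_scale) (simp only: ac_simps)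
    next
      case (add p q)
      then show ?case by (simp only: lin distrib_left scale_add) (simp only: ac_simps)
    next
      case zero
      show ?case using lin(2)[of 0 0] by simp
    qed
  next
    case (add p p')
    then show ?case by (simp only: lin distrib_right scale_add) (simp only: ac_simps)
  next
    case zero
    show ?case using lin(2)[of 0 0] by simp
  qed
  have "supp (?D p) \<subseteq> lists G" if "supp p \<subseteq> lists G" for p
    using supp[of p] mons that by blast
  moreover have "supp (?D p) \<subseteq> mons G deg (n + k)" if "supp p \<subseteq> mons G deg n" for p n
    using supp[of p] mons that by blast
  ultimately show ?thesis
    by (intro graded_derivationI) (simp_all only: lin mult)
qed

end

text \<open>Used to see that changing the values on generators of degree two does not alter a
  derivation on elements of degree one.\<close>

lemma derivation_ext_cong:
  assumes "\<And>m g. m \<in> supp p \<Longrightarrow> g \<in> set m \<Longrightarrow> \<delta> g = \<delta>' g"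
  shows "derivation_ext deg k \<delta> p = derivation_ext deg k \<delta>' p"
  unfolding derivation_ext_def using assms by (intro lin_ext_cong sum.cong) auto

section \<open>Reduction to normal form\<close>

text \<open>Replacing an element by finitely many smaller ones, possibly dropping others, decreases
  a finite set in the multiset extension of \<open>R\<close>, which is again well-founded. This
  drives both the reduction to irreducible elements and the removal of maximal grades.\<close>

lemma finite_set_replace_induct [consumes 2, case_names step]:
  assumes "wfp R" "finite A"
    and step: "\<And>A. finite A \<Longrightarrow>
      (\<And>a B. a \<in> A \<Longrightarrow> finite B \<Longrightarrow> B \<subseteq> (A - {a}) \<union> {b. R b a} \<Longrightarrow> P B) \<Longrightarrow> P A"
  shows "P A"
proof -
  have "wfp (multp R)" by (rule wfp_multp[OF \<open>wfp R\<close>])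
  then have "\<forall>A. finite A \<longrightarrow> M = mset_set A \<longrightarrow> P A" for M
  proof (induction M rule: wfp_induct_rule)
    case (less M)
    show ?case
    proof (intro allI impI)
      fix A assume "finite A" "M = mset_set A"
      show "P A"
      proof (rule step[OF \<open>finite A\<close>])
        fix a B
        assume "a \<in> A" "finite B" "B \<subseteq> (A - {a}) \<union> {b. R b a}"
        note A = \<open>finite A\<close> \<open>M = mset_set A\<close> this
        \<comment> \<open>The common part cancels; \<open>a\<close> remains on the larger side and
          dominates everything that is left of \<open>B\<close>.\<close>
        let ?I = "A \<inter> B - {a}"
        have "mset_set C = mset_set ?I + mset_set (C - ?I)" if "finite C" "?I \<subseteq> C" for C
          using mset_set_Union[of ?I "C - ?I"] that A(1) by (simp add: Un_absorb1)
        then have "mset_set B = mset_set ?I + mset_set (B - ?I)"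
          "mset_set A = mset_set ?I + mset_set (A - ?I)"
          using A(1,4) by blast+
        moreover have "multp R (mset_set ?I + mset_set (B - ?I)) (mset_set ?I + mset_set (A - ?I))"
        proof (rule one_step_implies_multp)
          show "mset_set (A - ?I) \<noteq> {#}"
            using A(1,3) by (auto simp: mset_set_empty_iff)
          show "\<forall>k\<in>#mset_set (B - ?I). \<exists>j\<in>#mset_set (A - ?I). R k j"
            using A(1,3-5) by (intro ballI bexI[of _ a]) auto
        qed
        ultimately have "multp R (mset_set B) M"
          using A(2) by simp
        then show "P B"
          using less A(4) by blast
      qed
    qed
  qed
  with \<open>finite A\<close> show ?thesis by blast
qed

definition reducible_word :: "'x set \<Rightarrow> 'x list set \<Rightarrow> 'x list \<Rightarrow> bool" where
  "reducible_word X W u \<longleftrightarrow> (\<exists>a w b. a \<in> lists X \<and> w \<in> W \<and> b \<in> lists X \<and> u = a @ w @ b)"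

lemma uminus_free_alg:
  assumes "p \<in> carrier (free_alg S)"
  shows "\<ominus>\<^bsub>free_alg S\<^esub> p = - (p :: 's list \<Rightarrow>\<^sub>0 'k::field)"
proof -
  interpret ring "free_alg S :: ('k, 's list \<Rightarrow>\<^sub>0 'k) module" by (rule ring_free_alg)
  show ?thesis using assms by (intro minus_equality) auto
qed

lemma minus_free_alg:
  assumes "p \<in> carrier (free_alg S)" "q \<in> carrier (free_alg S)"
  shows "p \<ominus>\<^bsub>free_alg S\<^esub> q = p - (q :: 's list \<Rightarrow>\<^sub>0 'k::field)"
  using assms(2) by (simp add: a_minus_def uminus_free_alg del: free_alg_simps(1))

section \<open>The ideal of relations and normal forms\<close>

locale terminating_rewriting =
  fixes X :: "'x set" and W :: "'x list set" and f :: "'x list \<Rightarrow> ('x list \<Rightarrow>\<^sub>0 'k::field)"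
  assumes system: "rewriting_system X W f" and terminating: "terminating X W f"
begin

abbreviation lt (infix "\<prec>" 50) where "v \<prec> u \<equiv> rw_less X W f v u"

abbreviation relator_ideal where "relator_ideal \<equiv> Idl\<^bsub>free_alg X\<^esub> (relators W f)"

sublocale free_alg: ring "free_alg X :: ('k, 'x list \<Rightarrow>\<^sub>0 'k) module"
  by (rule ring_free_alg)

lemma W_lists: "w \<in> W \<Longrightarrow> w \<in> lists X"
  and supp_f: "w \<in> W \<Longrightarrow> supp (f w) \<subseteq> lists X"
  using system by (auto simp: rewriting_system_def Pi_iff)

lemma wf_lt: "wfp (\<prec>)"
  using terminating by (simp add: terminating_def)

lemma irrefl_lt: "\<not> u \<prec> u"
  by (rule irreflpD[OF wfp_imp_irreflp[OF wf_lt]])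

lemma relators_carrier: "relators W f \<subseteq> carrier (free_alg X)"
proof
  fix p assume "p \<in> relators W f"
  then obtain w where "w \<in> W" "p = mono_of w - f w"
    unfolding relators_def by blast
  then have "supp p \<subseteq> lists X"
    using supp_diff_subset[of "mono_of w" "lists X" "f w"] W_lists supp_f by simp
  then show "p \<in> carrier (free_alg X)" by simp
qed

lemma ideal_relators: "ideal relator_ideal (free_alg X)"
  by (rule free_alg.genideal_ideal[OF relators_carrier])

lemma relator_ideal_zero: "0 \<in> relator_ideal"
  and relator_ideal_add: "p \<in> relator_ideal \<Longrightarrow> q \<in> relator_ideal \<Longrightarrow> p + q \<in> relator_ideal"
  and relator_ideal_mult: "supp a \<subseteq> lists X \<Longrightarrow> supp b \<subseteq> lists X \<Longrightarrow> p \<in> relator_ideal \<Longrightarrow>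
      a * p * b \<in> relator_ideal"
  and relator_ideal_scale: "p \<in> relator_ideal \<Longrightarrow> scale c p \<in> relator_ideal"
proof -
  interpret I: ideal relator_ideal "free_alg X" by (rule ideal_relators)
  show "0 \<in> relator_ideal" using I.zero_closed by simp
  show "p + q \<in> relator_ideal" if "p \<in> relator_ideal" "q \<in> relator_ideal"
    using I.a_closed[OF that] by simp
  show mult: "a * p * b \<in> relator_ideal"
    if "supp a \<subseteq> lists X" "supp b \<subseteq> lists X" "p \<in> relator_ideal" for a b
    using I.I_r_closed[OF I.I_l_closed[OF that(3), of a], of b] that by simp
  show "scale c p \<in> relator_ideal" if "p \<in> relator_ideal"
  proof -
    \<comment> \<open>Scalars act through the constants \<open>scale c 1\<close>, so an ideal of the
      ring is also a subspace.\<close>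
    have "supp (scale c 1 :: 'x list \<Rightarrow>\<^sub>0 'k) \<subseteq> lists X"
      by (intro supp_scale_subset) (simp add: zero_list_def)
    from mult[OF this _ that, of 1] show ?thesis
      by (simp add: scale_mult zero_list_def)
  qed
qed

lemma relator_context_ideal:
  assumes "a \<in> lists X" "w \<in> W" "b \<in> lists X"
  shows "mono_of a * (mono_of w - f w) * mono_of b \<in> relator_ideal"
proof -
  have "mono_of w - f w \<in> relator_ideal"
    using free_alg.genideal_self[OF relators_carrier] assms(2) by (auto simp: relators_def)
  with assms show ?thesis by (intro relator_ideal_mult) auto
qed

lemma supp_rewrite:
  assumes "a \<in> lists X" "w \<in> W" "b \<in> lists X"
  shows "supp (mono_of a * f w * mono_of b) \<subseteq> {v \<in> lists X. v \<prec> a @ w @ b}"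
proof -
  have "supp (mono_of a * f w * mono_of b) \<subseteq> {a @ v @ b | v. v \<in> supp (f w)}"
  proof
    fix x assume "x \<in> supp (mono_of a * f w * mono_of b)"
    then obtain y where "x = y @ b" "y \<in> supp (mono_of a * f w)"
      using supp_mult[of "mono_of a * f w" "mono_of b"] by auto
    then show "x \<in> {a @ v @ b | v. v \<in> supp (f w)}"
      using supp_mult[of "mono_of a" "f w"] by auto
  qed
  moreover have "a @ v @ b \<prec> a @ w @ b" "a @ v @ b \<in> lists X" if "v \<in> supp (f w)" for v
  proof -
    show "a @ v @ b \<prec> a @ w @ b"
      using assms that by (intro rw_context rw_rule)
    show "a @ v @ b \<in> lists X"
      using supp_f[OF assms(2)] that assms by auto
  qed
  ultimately show ?thesis by blast
qed

text \<open>In this form a reduction visibly subtracts a multiple of a relator in context, and it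
  fixes \<open>g\<close> when the coefficient of \<open>a @ w @ b\<close> vanishes.\<close>

lemma basic_reduction_eq:
  "basic_reduction f a w b g
    = g + scale (Poly_Mapping.lookup g (a @ w @ b)) (mono_of a * f w * mono_of b - mono_of (a @ w @ b))"
proof -
  have "supp g \<subseteq> UNIV" by simp
  then show ?thesis
  proof (induction g rule: linear_induct)
    case (add p q)
    have "basic_reduction f a w b (p + q) = basic_reduction f a w b p + basic_reduction f a w b q"
      by (simp add: basic_reduction_def lin_ext_add)
    then show ?case
      unfolding add.IH lookup_add scale_add_left by (simp only: ac_simps)
  next
    case (scale c m)
    show ?case
      by (cases "m = a @ w @ b") (simp_all add: basic_reduction_def lin_ext_scale lookup_mono_of scale_diff)
  qed (simp add: basic_reduction_def)
qed

text \<open>A reduction at \<open>a @ w @ b\<close> erases that monomial: the replacement involves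
  only strictly smaller words, and irreflexivity keeps the erased word from coming back. Hence
  exactly the elements without this monomial are fixed.\<close>

lemma irreducible_elt_iff:
  "irreducible_elt X W f g \<longleftrightarrow> supp g \<subseteq> lists X \<and> (\<forall>u\<in>supp g. \<not> reducible_word X W u)"
proof -
  have fix_iff: "basic_reduction f a w b g = g \<longleftrightarrow> a @ w @ b \<notin> supp g"
    if "a \<in> lists X" "w \<in> W" "b \<in> lists X" for a w b
  proof
    assume "basic_reduction f a w b g = g"
    then have "Poly_Mapping.lookup (basic_reduction f a w b g - g) (a @ w @ b) = 0" by simp
    moreover have "Poly_Mapping.lookup (mono_of a * f w * mono_of b) (a @ w @ b) = 0"
      using supp_rewrite[OF that] irrefl_lt by (auto simp: in_keys_iff)
    ultimately show "a @ w @ b \<notin> supp g"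
      by (simp add: basic_reduction_eq lookup_minus lookup_mono_of in_keys_iff)
  qed (simp add: basic_reduction_eq in_keys_iff)
  show ?thesis
    unfolding irreducible_elt_def basic_reductions_def reducible_word_def free_alg_simps
    using fix_iff by blast
qed

text \<open>Each reduction replaces one word of the support by smaller ones, so the process ends.
  The predicate \<open>Q\<close> records how the total change is assembled from relators in context,
  and the downward closed set \<open>U\<close> bounds the words at which they are applied. Its two
  instances are membership in the ideal and liftability along the twisted differential in small
  grades.\<close>

lemma reduce_to_irreducible:
  assumes "supp g \<subseteq> lists X" "supp g \<subseteq> U"
    and U: "\<And>u v. u \<in> U \<Longrightarrow> v \<prec> u \<Longrightarrow> v \<in> U"
    and "Q 0"
    and Q: "\<And>p c a w b. Q p \<Longrightarrow> a \<in> lists X \<Longrightarrow> w \<in> W \<Longrightarrow> b \<in> lists X \<Longrightarrow> a @ w @ b \<in> U \<Longrightarrow>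
      Q (p + scale c (mono_of a * (mono_of w - f w) * mono_of b))"
  shows "\<exists>h. irreducible_elt X W f h \<and> Q (g - h)"
proof -
  have reduce: "\<forall>g. supp g = A \<and> supp g \<subseteq> lists X \<and> supp g \<subseteq> U \<longrightarrow> (\<exists>h. irreducible_elt X W f h \<and> Q (g - h))"
    if "finite A" for A
    using wf_lt \<open>finite A\<close>
  proof (induction A rule: finite_set_replace_induct)
    case (step A)
    show ?case
    proof (intro allI impI, elim conjE)
      fix g :: "'x list \<Rightarrow>\<^sub>0 'k"
      assume g: "supp g = A" "supp g \<subseteq> lists X" "supp g \<subseteq> U"
      show "\<exists>h. irreducible_elt X W f h \<and> Q (g - h)"
      proof (cases "irreducible_elt X W f g")
        case True
        then show ?thesis using \<open>Q 0\<close> by (intro exI[of _ g]) simp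
      next
        case False
        then obtain a w b where awb: "a \<in> lists X" "w \<in> W" "b \<in> lists X" "a @ w @ b \<in> supp g"
          unfolding irreducible_elt_iff reducible_word_def using g(2) by blast
        define c where "c = Poly_Mapping.lookup g (a @ w @ b)"
        define r where "r = mono_of a * (mono_of w - f w) * mono_of b"
        let ?g = "g - scale c r"
        have r: "r = mono_of (a @ w @ b) - mono_of a * f w * mono_of b"
          by (simp add: r_def algebra_simps mono_of_append)
        have "Poly_Mapping.lookup (mono_of a * f w * mono_of b) (a @ w @ b) = 0"
          using supp_rewrite[OF awb(1-3)] irrefl_lt by (auto simp: in_keys_iff)
        then have "a @ w @ b \<notin> supp ?g"
          by (simp add: r c_def lookup_minus lookup_mono_of in_keys_iff)
        moreover have "supp ?g \<subseteq> supp g \<union> {v \<in> lists X. v \<prec> a @ w @ b}"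
        proof -
          have "supp r \<subseteq> {a @ w @ b} \<union> {v \<in> lists X. v \<prec> a @ w @ b}"
            unfolding r using supp_rewrite[OF awb(1-3)] by (intro supp_diff_subset) auto
          then have "supp (scale c r) \<subseteq> supp g \<union> {v \<in> lists X. v \<prec> a @ w @ b}"
            using awb(4) supp_scale[of c r] by blast
          then show ?thesis by (intro supp_diff_subset) auto
        qed
        ultimately have *: "supp ?g \<subseteq> A - {a @ w @ b} \<union> {v. v \<prec> a @ w @ b}"
          "supp ?g \<subseteq> lists X"
          using g by blast+
        moreover have "supp ?g \<subseteq> U"
          using *(1) g(1,3) awb(4) U by blast
        moreover have "a @ w @ b \<in> A" using awb(4) g(1) by simp
        ultimately obtain h where h: "irreducible_elt X W f h" "Q (?g - h)"
          using step(2)[OF _ finite_keys *(1)] by blast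
        \<comment> \<open>The induction hypothesis speaks of \<open>?g\<close>; adding back the
          subtracted relator gives the claim for \<open>g\<close>.\<close>
        have "Q (?g - h + scale c r)"
          unfolding r_def
          by (rule Q[OF h(2)[unfolded r_def] awb(1-3)]) (use awb(4) g(3) in blast)
        moreover have "?g - h + scale c r = g - h" by simp
        ultimately show ?thesis using h(1) by metis
      qed
    qed
  qed
  show ?thesis using reduce[OF finite_keys, of g] assms(1,2) by simp
qed

lemma normal_form_iff:
  assumes "supp g \<subseteq> lists X"
  shows "is_normal_form X W f g h \<longleftrightarrow> irreducible_elt X W f h \<and> h - g \<in> relator_ideal"
proof (cases "irreducible_elt X W f h")
  case True
  then have "supp h \<subseteq> lists X" by (simp add: irreducible_elt_def)
  with assms show ?thesis
    unfolding is_normal_form_def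
    using free_alg.quotient_eq_iff_same_a_r_cos[OF ideal_relators, of h g]
    by (simp add: minus_free_alg)
qed (simp add: is_normal_form_def)

text \<open>Reduction already yields existence of normal forms, so only uniqueness is at stake. Two
  normal forms of one element differ by an irreducible element of the ideal, and an irreducible
  element of the ideal is a normal form of \<open>0\<close> besides \<open>0\<close> itself.\<close>

lemma convergent_iff:
  "convergent X W f \<longleftrightarrow> (\<forall>g\<in>relator_ideal. irreducible_elt X W f g \<longrightarrow> g = 0)"
proof
  assume "convergent X W f"
  then have "\<exists>!h. is_normal_form X W f 0 h" by (simp add: convergent_def)
  moreover have "is_normal_form X W f 0 0"
    by (simp add: normal_form_iff irreducible_elt_iff relator_ideal_zero)
  moreover have "is_normal_form X W f 0 g"
    if "g \<in> relator_ideal" "irreducible_elt X W f g" for g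
    using that by (simp add: normal_form_iff)
  ultimately show "\<forall>g\<in>relator_ideal. irreducible_elt X W f g \<longrightarrow> g = 0" by blast
next
  assume zero: "\<forall>g\<in>relator_ideal. irreducible_elt X W f g \<longrightarrow> g = 0"
  have "\<exists>!h. is_normal_form X W f g h" if g: "supp g \<subseteq> lists X" for g
  proof (rule ex_ex1I)
    have "\<exists>h. irreducible_elt X W f h \<and> g - h \<in> relator_ideal"
      using g
      by (rule reduce_to_irreducible[where U = UNIV])
        (auto intro: relator_ideal_zero relator_ideal_add relator_ideal_scale relator_context_ideal)
    then obtain h where "irreducible_elt X W f h" "g - h \<in> relator_ideal" by blast
    then show "\<exists>h. is_normal_form X W f g h"
      using g relator_ideal_scale[of "g - h" "-1"] by (auto simp: normal_form_iff)
  next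
    fix h h'
    assume "is_normal_form X W f g h" "is_normal_form X W f g h'"
    then have h: "irreducible_elt X W f h" "irreducible_elt X W f h'"
      "h - g \<in> relator_ideal" "h' - g \<in> relator_ideal"
      using g by (simp_all add: normal_form_iff)
    have "(h - g) + scale (-1) (h' - g) \<in> relator_ideal"
      using h by (intro relator_ideal_add relator_ideal_scale)
    then have "h - h' \<in> relator_ideal" by simp
    moreover have "irreducible_elt X W f (h - h')"
      using h supp_diff[of h h'] unfolding irreducible_elt_iff by blast
    ultimately have "h - h' = 0" using zero by blast
    then show "h = h'" by simp
  qed
  then show "convergent X W f"
    using terminating by (simp add: convergent_def)
qed

end

section \<open>Word-homogeneous acyclic extensions\<close>

locale word_hom_extension = terminating_rewriting X W f
  for X :: "'x set" and W :: "'x list set" and f :: "'x list \<Rightarrow> ('x list \<Rightarrow>\<^sub>0 'k::field)" +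
  fixes G :: "'g set" and deg :: "'g \<Rightarrow> int" and wt :: "'g \<Rightarrow> 'x list"
    and d :: "('g list \<Rightarrow>\<^sub>0 'k) \<Rightarrow> ('g list \<Rightarrow>\<^sub>0 'k)" and \<iota> :: "'x sha_gen \<Rightarrow> 'g"
    and \<phi> :: "('g list \<Rightarrow>\<^sub>0 'k) \<Rightarrow> ('x list \<Rightarrow>\<^sub>0 'k) set"
  assumes extension: "word_hom_acyclic_extension X W G deg wt d \<iota> \<phi>"
begin

abbreviation T where "T \<equiv> quasi_free G deg d"

abbreviation word :: "'g list \<Rightarrow> 'x list" where "word m \<equiv> concat (map wt m)"

definition emb :: "('x list \<Rightarrow>\<^sub>0 'k) \<Rightarrow> ('g list \<Rightarrow>\<^sub>0 'k)" where
  "emb = rename_gens (\<lambda>x. \<iota> (Var x))"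

text \<open>Every letter is replaced by its grade, generators of positive degree included. This
  makes \<open>proj\<close> multiplicative on all of \<open>T(V)\<close>, and on degree zero it is
  inverse to \<open>emb\<close>.\<close>

definition proj :: "('g list \<Rightarrow>\<^sub>0 'k) \<Rightarrow> ('x list \<Rightarrow>\<^sub>0 'k)" where
  "proj = lin_ext (\<lambda>m. mono_of (word m))"

section \<open>Consequences of the axioms of the extension\<close>

lemma model: "is_model G deg d (mono_alg X W) \<phi>"
  and homogeneous: "word_homogeneous X T (word_part G wt)"
  using extension by (simp_all add: word_hom_acyclic_extension_def acyclic_extension_def)

sublocale T: assoc_algebra scalars T
  using model by (simp add: is_model_def dg_algebra_def)

lemma d_derivation: "graded_derivation T (-1) d"
  and d_square: "supp p \<subseteq> lists G \<Longrightarrow> d (d p) = 0"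
  using model by (simp_all add: is_model_def dg_algebra_def)

text \<open>A generator of negative degree would be a nonzero element of a negative
  component.\<close>

lemma deg_nonneg: "g \<in> G \<Longrightarrow> 0 \<le> deg g"
proof (rule ccontr)
  assume g: "g \<in> G" "\<not> 0 \<le> deg g"
  have "\<forall>n<0. hpart T n = {0}"
    using extension unfolding word_hom_acyclic_extension_def acyclic_extension_def by blast
  then have "hpart T (deg g) = {0}" using g(2) by (simp del: quasi_free_simps)
  moreover have "mono_of [g] \<in> hpart T (deg g)" using g(1) by simp
  ultimately have "(mono_of [g] :: 'g list \<Rightarrow>\<^sub>0 'k) = 0" by (simp del: quasi_free_simps)
  then have "supp (mono_of [g] :: 'g list \<Rightarrow>\<^sub>0 'k) = supp (0 :: 'g list \<Rightarrow>\<^sub>0 'k)" by (rule arg_cong)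
  then show False by simp
qed

lemma \<iota>_bij: "bij_betw \<iota> (sha_gens X W) {g \<in> G. deg g \<in> {0, 1}}"
  and \<iota>_deg: "s \<in> sha_gens X W \<Longrightarrow> deg (\<iota> s) = sha_deg s"
  and d_\<iota>: "s \<in> sha_gens X W \<Longrightarrow>
    d (mono_of [\<iota> s]) = rename_gens \<iota> (dif (shafarevich X W) (mono_of [s]))"
  using extension by (simp_all add: word_hom_acyclic_extension_def acyclic_extension_def)

lemma \<iota>_Var: "x \<in> X \<Longrightarrow> \<iota> (Var x) \<in> G" "x \<in> X \<Longrightarrow> deg (\<iota> (Var x)) = 0" "x \<in> X \<Longrightarrow> wt (\<iota> (Var x)) = [x]"
  and \<iota>_Rel: "w \<in> W \<Longrightarrow> \<iota> (Rel w) \<in> G" "w \<in> W \<Longrightarrow> deg (\<iota> (Rel w)) = 1" "w \<in> W \<Longrightarrow> wt (\<iota> (Rel w)) = w"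
  using \<iota>_bij \<iota>_deg extension
  by (auto simp: bij_betw_def sha_gens_def word_hom_acyclic_extension_def)

lemma deg_zero_gen: "g \<in> G \<Longrightarrow> deg g = 0 \<Longrightarrow> \<exists>x\<in>X. g = \<iota> (Var x)"
  and deg_one_gen: "g \<in> G \<Longrightarrow> deg g = 1 \<Longrightarrow> \<exists>w\<in>W. g = \<iota> (Rel w)"
proof -
  have "\<exists>s\<in>sha_gens X W. g = \<iota> s" if "g \<in> G" "deg g \<in> {0, 1}" for g
    using \<iota>_bij that by (auto simp: bij_betw_def image_iff set_eq_iff)
  then show "g \<in> G \<Longrightarrow> deg g = 0 \<Longrightarrow> \<exists>x\<in>X. g = \<iota> (Var x)"
    "g \<in> G \<Longrightarrow> deg g = 1 \<Longrightarrow> \<exists>w\<in>W. g = \<iota> (Rel w)"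
    using \<iota>_Rel(2) \<iota>_Var(2) by (fastforce simp: sha_gens_def)+
qed

lemma d_Rel: "w \<in> W \<Longrightarrow> d (mono_of [\<iota> (Rel w)]) = emb (mono_of w)"
  using d_\<iota>[of "Rel w"]
  by (simp add: sha_gens_def shafarevich_def derivation_ext_gen emb_def comp_def)

lemma finsum_T:
  assumes "finite I" "\<And>i. i \<in> I \<Longrightarrow> supp (c i) \<subseteq> lists G"
  shows "(\<Oplus>\<^bsub>T\<^esub>i\<in>I. c i) = sum c I"
  using assms
proof (induction I)
  case (insert i I)
  then show ?case by (subst T.finsum_insert) auto
qed simp

text \<open>The values of \<open>wt\<close> are a priori arbitrary lists. That they are words over
  \<open>X\<close> follows by decomposing \<open>mono_of [g]\<close> along the grades in
  \<open>lists X\<close>: one of the components must contain the monomial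
  \<open>[g]\<close>.\<close>

lemma wt_lists:
  assumes "g \<in> G"
  shows "wt g \<in> lists X"
proof -
  have "is_direct_sum T (carrier T) (lists X) (word_part G wt)"
    using homogeneous by (simp add: word_homogeneous_def)
  moreover have "mono_of [g] \<in> carrier T"
    using assms by simp
  ultimately have "\<exists>!c. (\<forall>i\<in>lists X. c i \<in> word_part G wt i) \<and> (\<forall>i. i \<notin> lists X \<longrightarrow> c i = \<zero>\<^bsub>T\<^esub>) \<and>
      finite {i. c i \<noteq> \<zero>\<^bsub>T\<^esub>} \<and> mono_of [g] = (\<Oplus>\<^bsub>T\<^esub>i\<in>{i. c i \<noteq> \<zero>\<^bsub>T\<^esub>}. c i)"
    unfolding is_direct_sum_def by blast
  then obtain c where c: "\<And>i. i \<in> lists X \<Longrightarrow> c i \<in> word_part G wt i" "\<And>i. i \<notin> lists X \<Longrightarrow> c i = 0"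
    "finite {i. c i \<noteq> 0}" "mono_of [g] = (\<Oplus>\<^bsub>T\<^esub>i\<in>{i. c i \<noteq> 0}. c i)"
    unfolding quasi_free_simps by (elim ex1E conjE) blast
  have "supp (c i) \<subseteq> lists G" for i
    using c(1,2)[of i] by (cases "i \<in> lists X") (auto simp: word_part_def)
  then have "mono_of [g] = sum c {i. c i \<noteq> 0}"
    unfolding c(4) using c(3) by (intro finsum_T)
  then have "[g] \<in> (\<Union>i\<in>{i. c i \<noteq> 0}. supp (c i))"
    using supp_sum[of c "{i. c i \<noteq> 0}"] supp_mono_of[of "[g]", where 'k = 'k] by simp
  then obtain i where "c i \<noteq> 0" "[g] \<in> supp (c i)" by blast
  then show ?thesis
    using c(1,2)[of i] by (fastforce simp: word_part_def)
qed

lemma word_lists: "m \<in> lists G \<Longrightarrow> word m \<in> lists X"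
  using wt_lists by fastforce

lemma d_word:
  assumes "m \<in> lists G"
  shows "supp (d (mono_of m)) \<subseteq> {n \<in> lists G. word n = word m}"
proof -
  have "\<forall>u\<in>lists X. subcomplex T (word_part G wt u)"
    using homogeneous by (simp add: word_homogeneous_def)
  then have "d ` word_part G wt (word m) \<subseteq> word_part G wt (word m)"
    using word_lists[OF assms] by (simp add: subcomplex_def)
  moreover have "mono_of m \<in> word_part G wt (word m)"
    using assms by (simp add: word_part_def)
  ultimately have "d (mono_of m) \<in> word_part G wt (word m)" by blast
  then show ?thesis by (auto simp: word_part_def)
qed

section \<open>Monomials of degree zero and one, and their grades\<close>

lemma deg_sum_nonneg: "m \<in> lists G \<Longrightarrow> 0 \<le> sum_list (map deg m)"
  using deg_nonneg by (auto intro!: sum_list_nonneg)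

lemma deg_le_sum: "m \<in> lists G \<Longrightarrow> g \<in> set m \<Longrightarrow> deg g \<le> sum_list (map deg m)"
  by (induction m) (use deg_nonneg deg_sum_nonneg in fastforce)+

lemma mons_negative: "n < 0 \<Longrightarrow> mons G deg n = {}"
  using deg_sum_nonneg by fastforce

text \<open>Degrees of letters are nonnegative, so every letter has degree zero and is of the form
  \<open>\<iota> (Var x)\<close>; its grade recovers \<open>x\<close>.\<close>

lemma mons_zero: "m \<in> mons G deg 0 \<Longrightarrow> m = map (\<lambda>x. \<iota> (Var x)) (word m)"
proof (induction m)
  case (Cons g m)
  then have "deg g = 0" "g \<in> G" "m \<in> mons G deg 0"
    using deg_nonneg[of g] deg_sum_nonneg[of m] by auto
  then show ?case using Cons.IH deg_zero_gen[of g] \<iota>_Var(3) by auto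
qed simp

text \<open>Some letter has degree one; it is an \<open>e\<^sub>w\<close>, and its grade
  \<open>w\<close> is a factor of the grade of the whole monomial.\<close>

lemma mons_one: "m \<in> mons G deg 1 \<Longrightarrow> reducible_word X W (word m)"
proof (induction m)
  case (Cons g m)
  then have g: "g \<in> G" "m \<in> lists G" "0 \<le> deg g" "0 \<le> sum_list (map deg m)"
    "deg g + sum_list (map deg m) = 1"
    using deg_nonneg[of g] deg_sum_nonneg[of m] by auto
  then consider "deg g = 0" "m \<in> mons G deg 1" | "deg g = 1" by fastforce
  then show ?case
  proof cases
    case 1
    then obtain a w b where "a \<in> lists X" "w \<in> W" "b \<in> lists X" "word m = a @ w @ b"
      using Cons.IH unfolding reducible_word_def by blast
    then show ?thesis
      unfolding reducible_word_def
      using wt_lists[OF g(1)] by (intro exI[of _ "wt g @ a"] exI[of _ w] exI[of _ b]) auto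
  next
    case 2
    then obtain w where "w \<in> W" "g = \<iota> (Rel w)" using deg_one_gen g(1) by blast
    then show ?thesis
      unfolding reducible_word_def using word_lists[OF g(2)] \<iota>_Rel(3)
      by (intro exI[of _ "[]"] exI[of _ w] exI[of _ "word m"]) auto
  qed
qed simp

section \<open>The degree zero part as the free algebra on \<open>X\<close>\<close>

lemma word_emb: "m \<in> lists X \<Longrightarrow> word (map (\<lambda>x. \<iota> (Var x)) m) = m"
  by (induction m) (auto simp: \<iota>_Var)

lemma emb_mons: "m \<in> lists X \<Longrightarrow> map (\<lambda>x. \<iota> (Var x)) m \<in> mons G deg 0"
  by (induction m) (auto simp: \<iota>_Var)

lemma supp_emb: "supp p \<subseteq> lists X \<Longrightarrow> supp (emb p) \<subseteq> mons G deg 0"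
  unfolding emb_def using supp_rename_gens[of "\<lambda>x. \<iota> (Var x)" p] emb_mons by blast

lemma emb_add: "emb (p + q) = emb p + emb q"
  and emb_diff: "emb (p - q) = emb p - emb q"
  and emb_scale: "emb (scale c p) = scale c (emb p)"
  and emb_zero: "emb 0 = 0"
  and emb_mono_of: "emb (mono_of m) = mono_of (map (\<lambda>x. \<iota> (Var x)) m)"
  by (simp_all add: emb_def rename_gens_def lin_ext_add lin_ext_diff lin_ext_scale)

lemma emb_mult: "emb (p * q) = emb p * emb q"
  by (simp add: emb_def rename_gens_mult)

lemma proj_add: "proj (p + q) = proj p + proj q"
  and proj_scale: "proj (scale c p) = scale c (proj p)"
  and proj_zero: "proj 0 = 0"
  and proj_mono_of: "proj (mono_of m) = mono_of (word m)"
  by (simp_all add: proj_def lin_ext_add lin_ext_scale)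

lemma proj_mult: "proj (p * q) = proj p * proj q"
  unfolding proj_def by (rule lin_ext_mono_mult) simp

lemma proj_emb: "supp p \<subseteq> lists X \<Longrightarrow> proj (emb p) = p"
  by (induction p rule: linear_induct)
    (simp_all add: emb_zero emb_add emb_scale emb_mono_of proj_zero proj_add proj_scale proj_mono_of word_emb
      del: map_map)

lemma emb_proj: "supp p \<subseteq> mons G deg 0 \<Longrightarrow> emb (proj p) = p"
proof (induction p rule: linear_induct)
  case (scale c m)
  then show ?case using mons_zero[of m] by (simp add: proj_scale emb_scale emb_mono_of proj_mono_of)
qed (simp_all add: emb_zero emb_add proj_zero proj_add)

lemma supp_proj: "supp p \<subseteq> lists G \<Longrightarrow> supp (proj p) \<subseteq> word ` supp p"
  using supp_lin_ext[of "\<lambda>m. mono_of (word m) :: 'x list \<Rightarrow>\<^sub>0 'k" p] by (auto simp: proj_def)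

text \<open>The monomial algebra has no nonzero element in degree one, so its first homology has at
  most one class. Injectivity of the quasi-isomorphism on homology makes every cycle homologous to
  \<open>0\<close>.\<close>

lemma exact_degree_one:
  assumes z: "supp z \<subseteq> mons G deg 1" "d z = 0"
  shows "\<exists>y. supp y \<subseteq> mons G deg 2 \<and> d y = z"
proof -
  let ?M = "mono_alg X W :: ('k, ('x list \<Rightarrow>\<^sub>0 'k) set) dg_alg"
  let ?C = "cycle_group T 1" and ?B = "boundaries T 1"
  have "quasi_iso T ?M \<phi>" using model by (simp add: is_model_def)
  then have inj: "inj_on (homology_map ?M 1 \<phi>) (carrier (homology T 1))"
    and sub: "homology_map ?M 1 \<phi> ` carrier (homology T 1) = carrier (homology ?M 1)"
    by (auto simp: quasi_iso_def iso_def bij_betw_def)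
  have "carrier (cycle_group ?M 1) \<subseteq> {\<zero>\<^bsub>?M\<^esub>}"
    by (auto simp: cycle_group_def mono_alg_def conc_zero_def dg_alg.defs module.defs)
  then have trivial: "carrier (homology ?M 1) \<subseteq> {boundaries ?M 1 #>\<^bsub>cycle_group ?M 1\<^esub> \<zero>\<^bsub>?M\<^esub>}"
    by (auto simp: homology_def FactGroup_def RCOSETS_def)
  have "z \<in> carrier ?C" "0 \<in> carrier ?C"
    using z by (simp_all add: cycle_group_def derivation_zero[OF d_derivation])
  then have cosets: "?B #>\<^bsub>?C\<^esub> z \<in> carrier (homology T 1)"
    "?B #>\<^bsub>?C\<^esub> 0 \<in> carrier (homology T 1)"
    by (auto simp: homology_def FactGroup_def RCOSETS_def)
  let ?h = "homology_map ?M 1 \<phi>"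
  have "?h (?B #>\<^bsub>?C\<^esub> z) = ?h (?B #>\<^bsub>?C\<^esub> 0)"
    using cosets[THEN imageI, of ?h, THEN subsetD[OF trivial[folded sub]], THEN singletonD]
    by (rule trans[OF _ sym])
  then have "?B #>\<^bsub>?C\<^esub> z = ?B #>\<^bsub>?C\<^esub> 0"
    using cosets by (rule inj_onD[OF inj])
  \<comment> \<open>The cycle \<open>z\<close> lies in its own coset because \<open>0\<close> is a
    boundary, while the coset of \<open>0\<close> consists of the boundaries.\<close>
  moreover have "z \<in> ?B #>\<^bsub>?C\<^esub> z"
  proof -
    have "0 \<in> ?B"
      unfolding boundaries_def using derivation_zero[OF d_derivation] by (force simp: image_iff)
    then show ?thesis by (force simp: r_coset_def cycle_group_def)
  qed
  ultimately have "z \<in> ?B" by (simp add: r_coset_def cycle_group_def)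
  then show ?thesis by (auto simp: boundaries_def)
qed

section \<open>Projection onto a word-homogeneous component\<close>

definition part :: "'x list \<Rightarrow> ('g list \<Rightarrow>\<^sub>0 'k) \<Rightarrow> ('g list \<Rightarrow>\<^sub>0 'k)" where
  "part u = lin_ext (\<lambda>m. if word m = u then mono_of m else 0)"

lemma lookup_part: "Poly_Mapping.lookup (part u p) n = (if word n = u then Poly_Mapping.lookup p n else 0)"
proof -
  have "supp p \<subseteq> UNIV" by simp
  then show ?thesis
    by (induction p rule: linear_induct)
      (auto simp: part_def lin_ext_add lin_ext_scale lookup_add lookup_mono_of)
qed

lemma supp_part: "supp (part u p) = {m \<in> supp p. word m = u}"
  by (auto simp: in_keys_iff lookup_part split: if_splits)

lemma part_add: "part u (p + q) = part u p + part u q"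
  and part_scale: "part u (scale c p) = scale c (part u p)"
  and part_zero: "part u 0 = 0"
  by (simp_all add: part_def lin_ext_add lin_ext_scale)

lemma part_eq: "supp p \<subseteq> {m. word m = u} \<Longrightarrow> part u p = p"
  by (rule poly_mapping_eqI) (auto simp: lookup_part in_keys_iff)

lemma part_eq_zero: "supp p \<subseteq> {m. word m \<noteq> u} \<Longrightarrow> part u p = 0"
  by (rule poly_mapping_eqI) (auto simp: lookup_part in_keys_iff)

text \<open>The differential preserves grades. This permits passing to one grade both in a cycle and
  in an element it bounds.\<close>

lemma d_part:
  assumes "supp p \<subseteq> lists G"
  shows "d (part u p) = part u (d p)"
  using assms
proof (induction p rule: linear_induct)
  case zero
  show ?case by (simp add: part_zero derivation_zero[OF d_derivation])
next
  case (add p q)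
  have "supp (part u p) \<subseteq> lists G" "supp (part u q) \<subseteq> lists G"
    using add.hyps by (auto simp: supp_part)
  with add show ?case by (simp add: part_add derivation_add[OF d_derivation])
next
  case (scale c m)
  have "part u (d (mono_of m)) = d (part u (mono_of m))"
  proof (cases "word m = u")
    case True
    then show ?thesis
      using d_word[OF scale] by (subst (1 2) part_eq) auto
  next
    case False
    then show ?thesis
      using d_word[OF scale] by (subst (1 2) part_eq_zero) (auto simp: derivation_zero[OF d_derivation])
  qed
  moreover have "supp (part u (mono_of m)) \<subseteq> lists G"
    using scale by (auto simp: supp_part)
  ultimately show ?case
    using scale by (simp add: part_scale derivation_scale[OF d_derivation])
qed

end

section \<open>Perturbed differentials\<close>

context word_hom_extension
begin

lemma derivation_mons_zero:
  assumes E: "graded_derivation T (-1) E" and p: "supp p \<subseteq> mons G deg 0"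
  shows "E p = 0"
proof -
  have "supp (E p) \<subseteq> mons G deg (-1)"
    by (rule derivation_mons[OF E p]) simp
  then show ?thesis by (simp add: mons_negative)
qed

text \<open>Elements of degree zero are killed by \<open>E\<close> for degree reasons and contribute
  no sign, so \<open>E\<close> is a bimodule map over the degree zero part.\<close>

lemma derivation_context:
  assumes E: "graded_derivation T (-1) E"
    and p: "supp p \<subseteq> mons G deg 0" and q: "supp q \<subseteq> mons G deg 0" and z: "supp z \<subseteq> mons G deg i"
  shows "E (p * z * q) = p * E z * q"
proof -
  have lists: "supp q \<subseteq> lists G" "supp z \<subseteq> lists G" using q z by auto
  then have "supp (z * q) \<subseteq> lists G" by (intro supp_mult_lists)
  from derivation_mult[OF E p this] have "E (p * (z * q)) = p * E (z * q)"
    by (simp add: derivation_mons_zero[OF E p])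
  also have "E (z * q) = E z * q"
    using derivation_mult[OF E z lists(1)] by (simp add: derivation_mons_zero[OF E q])
  finally show ?thesis by (simp only: mult.assoc)
qed

end

text \<open>Only the values of \<open>F\<close> on the generators \<open>e\<^sub>w\<close> are
  fixed; conditions in degree two are left to single lemmas. The locale thus also covers the
  provisional derivation from which the final one is built.\<close>

locale twisted_extension = word_hom_extension X W f G deg wt d \<iota> \<phi>
  for X :: "'x set" and W :: "'x list set" and f :: "'x list \<Rightarrow> ('x list \<Rightarrow>\<^sub>0 'k::field)"
    and G :: "'g set" and deg :: "'g \<Rightarrow> int" and wt :: "'g \<Rightarrow> 'x list"
    and d :: "('g list \<Rightarrow>\<^sub>0 'k) \<Rightarrow> ('g list \<Rightarrow>\<^sub>0 'k)" and \<iota> :: "'x sha_gen \<Rightarrow> 'g"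
    and \<phi> :: "('g list \<Rightarrow>\<^sub>0 'k) \<Rightarrow> ('x list \<Rightarrow>\<^sub>0 'k) set" +
  fixes F :: "('g list \<Rightarrow>\<^sub>0 'k) \<Rightarrow> ('g list \<Rightarrow>\<^sub>0 'k)"
  assumes F_derivation: "graded_derivation T (-1) F"
    and F_Rel: "w \<in> W \<Longrightarrow> F (mono_of [\<iota> (Rel w)]) = - emb (f w)"
begin

definition D :: "('g list \<Rightarrow>\<^sub>0 'k) \<Rightarrow> ('g list \<Rightarrow>\<^sub>0 'k)" where
  "D p = d p + F p"

lemma D_derivation: "graded_derivation T (-1) D"
  using graded_derivation_add[OF d_derivation F_derivation] by (simp add: D_def[abs_def])

lemma D_Rel: "w \<in> W \<Longrightarrow> D (mono_of [\<iota> (Rel w)]) = emb (mono_of w - f w)"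
  by (simp add: D_def d_Rel F_Rel emb_diff)

text \<open>The Leibniz rule alters one letter at a time, and \<open>\<prec>\<close> is stable under
  multiplication by words on either side.\<close>

lemma F_lowers:
  assumes "m \<in> lists G" "\<And>g. g \<in> set m \<Longrightarrow> supp (F (mono_of [g])) \<subseteq> {n. word n \<prec> wt g}"
  shows "supp (F (mono_of m)) \<subseteq> {n. word n \<prec> word m}"
  using assms
proof (induction m)
  case Nil
  show ?case by (simp add: derivation_one[OF F_derivation])
next
  case (Cons g m)
  have g: "g \<in> G" "m \<in> lists G" using Cons.hyps by auto
  have "supp (F (mono_of [g]) * mono_of m) \<subseteq> {n. word n \<prec> word (g # m)}"
  proof
    fix x assume "x \<in> supp (F (mono_of [g]) * mono_of m)"
    then obtain n where n: "x = n @ m" "n \<in> supp (F (mono_of [g]))"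
      using supp_mult[of "F (mono_of [g])" "mono_of m"] by auto
    then have "word n \<prec> wt g" using Cons.prems(1)[of g] by auto
    then have "[] @ word n @ word m \<prec> [] @ wt g @ word m"
      using word_lists[OF g(2)] by (intro rw_context) auto
    then show "x \<in> {n. word n \<prec> word (g # m)}" using n(1) by simp
  qed
  moreover have "supp (mono_of [g] * F (mono_of m)) \<subseteq> {n. word n \<prec> word (g # m)}"
  proof
    fix x assume "x \<in> supp (mono_of [g] * F (mono_of m))"
    then obtain n where n: "x = g # n" "n \<in> supp (F (mono_of m))"
      using supp_mult[of "mono_of [g]" "F (mono_of m)"] by auto
    then have "word n \<prec> word m" using Cons.IH Cons.prems by auto
    then have "wt g @ word n @ [] \<prec> wt g @ word m @ []"
      using wt_lists[OF g(1)] by (intro rw_context) auto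
    then show "x \<in> {n. word n \<prec> word (g # m)}" using n(1) by simp
  qed
  ultimately show ?case
    unfolding derivation_Cons[OF F_derivation g] by (intro supp_add_subset supp_scale_subset)
qed

text \<open>In degree zero \<open>F\<close> vanishes by degree; in degree one it is given by
  \<open>f w\<close>, whose words lie below \<open>w\<close> by the definition of
  \<open>\<prec>\<close>.\<close>

lemma F_lowers_gen:
  assumes "g \<in> G" "deg g \<le> 1"
  shows "supp (F (mono_of [g])) \<subseteq> {n. word n \<prec> wt g}"
proof (cases "deg g = 0")
  case True
  then have "F (mono_of [g]) = 0"
    using assms by (intro derivation_mons_zero[OF F_derivation]) auto
  then show ?thesis by simp
next
  case False
  then obtain w where w: "w \<in> W" "g = \<iota> (Rel w)"
    using deg_one_gen[of g] deg_nonneg[of g] assms by force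
  have "word n \<prec> w" if n: "n \<in> supp (emb (f w))" for n
  proof -
    obtain v where v: "v \<in> supp (f w)" "n = map (\<lambda>x. \<iota> (Var x)) v"
      using n supp_rename_gens[of "\<lambda>x. \<iota> (Var x)" "f w"] unfolding emb_def by blast
    then have "word n = v" using supp_f[OF w(1)] word_emb[of v] by (simp del: map_map) blast
    then show ?thesis using rw_rule[of w W v f X] w(1) v(1) by simp
  qed
  then show ?thesis using w by (auto simp: F_Rel \<iota>_Rel(3))
qed

text \<open>The last hypothesis concerns generators of degree between two and \<open>i\<close>. It
  is vacuous for \<open>i = 1\<close>, and for \<open>i = 2\<close> it is the filtration condition
  on generators of degree two.\<close>

lemma F_lowers_mons:
  assumes "supp p \<subseteq> mons G deg i" "n \<in> supp (F p)"
    and "\<And>g. g \<in> G \<Longrightarrow> 1 < deg g \<Longrightarrow> deg g \<le> i \<Longrightarrow> supp (F (mono_of [g])) \<subseteq> {n. word n \<prec> wt g}"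
  shows "\<exists>m\<in>supp p. word n \<prec> word m"
proof -
  have "supp p \<subseteq> lists G" using assms(1) by auto
  from subsetD[OF supp_derivation[OF F_derivation this] assms(2)]
  obtain m where m: "m \<in> supp p" "n \<in> supp (F (mono_of m))" by auto
  then have "m \<in> lists G" "sum_list (map deg m) = i" using assms(1) by auto
  moreover have "supp (F (mono_of [g])) \<subseteq> {n. word n \<prec> wt g}" if "g \<in> set m" for g
    using deg_le_sum[of m g] assms(3)[of g] F_lowers_gen[of g] calculation that by (cases "deg g \<le> 1") auto
  ultimately show ?thesis using F_lowers[of m] m by blast
qed

section \<open>Boundaries of degree one elements and the ideal of relations\<close>

lemma proj_boundary_mono:
  "m \<in> mons G deg 1 \<Longrightarrow> proj (D (mono_of m)) \<in> relator_ideal"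
proof (induction m)
  case (Cons g m)
  then have g: "g \<in> G" "m \<in> lists G" "0 \<le> deg g" "0 \<le> sum_list (map deg m)"
    "deg g + sum_list (map deg m) = 1"
    using deg_nonneg[of g] deg_sum_nonneg[of m] by auto
  \<comment> \<open>The single letter of degree one stands in the tail or at the head; in the latter
    case the boundary is a relator times the word of the tail.\<close>
  then consider "deg g = 0" "m \<in> mons G deg 1" | "deg g = 1" "m \<in> mons G deg 0" by fastforce
  then show ?case
  proof cases
    case 1
    then have "D (mono_of [g] * mono_of m * 1) = mono_of [g] * D (mono_of m) * 1"
      using g(1) by (intro derivation_context[OF D_derivation]) (auto simp: zero_list_def)
    then have "proj (D (mono_of (g # m))) = mono_of (wt g) * proj (D (mono_of m)) * 1"
      by (simp add: mono_of_Cons[of g m] proj_mult proj_mono_of)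
    moreover have "mono_of (wt g) * proj (D (mono_of m)) * 1 \<in> relator_ideal"
      using Cons.IH[OF 1(2)] wt_lists[OF g(1)] by (intro relator_ideal_mult) (auto simp: zero_list_def)
    ultimately show ?thesis by simp
  next
    case 2
    then obtain w where w: "w \<in> W" "g = \<iota> (Rel w)" using deg_one_gen g(1) by blast
    have "D (1 * mono_of [g] * mono_of m) = 1 * D (mono_of [g]) * mono_of m"
      using g(1) 2 by (intro derivation_context[OF D_derivation, where i = 1]) (auto simp: zero_list_def)
    moreover have "supp (mono_of w - f w) \<subseteq> lists X"
      using W_lists[OF w(1)] supp_f[OF w(1)] by (intro supp_diff_subset) auto
    ultimately have "proj (D (mono_of (g # m))) = mono_of [] * (mono_of w - f w) * mono_of (word m)"
      using w by (simp add: mono_of_Cons[of _ m] proj_mult proj_mono_of D_Rel proj_emb)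
    then show ?thesis
      using relator_context_ideal[OF _ w(1) word_lists[OF g(2)], of "[]"] by simp
  qed
qed simp

lemma proj_boundary: "supp z \<subseteq> mons G deg 1 \<Longrightarrow> proj (D z) \<in> relator_ideal"
proof (induction z rule: linear_induct)
  case zero
  show ?case by (simp add: derivation_zero[OF D_derivation] proj_zero relator_ideal_zero)
next
  case (add p q)
  then have "supp p \<subseteq> lists G" "supp q \<subseteq> lists G" by auto
  with add show ?case by (simp add: derivation_add[OF D_derivation] proj_add relator_ideal_add)
next
  case (scale c m)
  then have "D (scale c (mono_of m)) = scale c (D (mono_of m))"
    by (intro derivation_scale[OF D_derivation]) auto
  then show ?case
    using proj_boundary_mono[OF scale] by (simp add: proj_scale relator_ideal_scale)
qed

lemma D_add: "supp p \<subseteq> mons G deg i \<Longrightarrow> supp q \<subseteq> mons G deg j \<Longrightarrow> D (p + q) = D p + D q"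
  and D_diff: "supp p \<subseteq> mons G deg i \<Longrightarrow> supp q \<subseteq> mons G deg j \<Longrightarrow> D (p - q) = D p - D q"
  and D_scale: "supp p \<subseteq> mons G deg i \<Longrightarrow> D (scale c p) = scale c (D p)"
  using D_derivation
  by (auto intro!: derivation_add derivation_diff derivation_scale)

text \<open>The elements \<open>p\<close> for which \<open>emb p\<close> is such a boundary form a
  two-sided ideal, since \<open>D\<close> is linear over the degree zero part on both sides. It
  contains the relators, which are the boundaries of the \<open>e\<^sub>w\<close>.\<close>

lemma relator_ideal_boundary:
  assumes "p \<in> relator_ideal"
  shows "\<exists>z. supp z \<subseteq> mons G deg 1 \<and> D z = emb p"
proof -
  let ?I = "{p. supp p \<subseteq> lists X \<and> (\<exists>z. supp z \<subseteq> mons G deg 1 \<and> D z = emb p)}"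
  have zero: "0 \<in> ?I"
    by (auto intro!: exI[of _ 0] simp: derivation_zero[OF D_derivation] emb_zero)
  have add: "p + q \<in> ?I" if "p \<in> ?I" "q \<in> ?I" for p q
  proof -
    obtain y z where "supp y \<subseteq> mons G deg 1" "D y = emb p" "supp z \<subseteq> mons G deg 1" "D z = emb q"
      using \<open>p \<in> ?I\<close> \<open>q \<in> ?I\<close> by blast
    then have "supp (y + z) \<subseteq> mons G deg 1" "D (y + z) = emb (p + q)"
      by (simp_all add: D_add emb_add supp_add_subset del: mem_Collect_eq)
    then show ?thesis using that supp_add_subset[of p "lists X" q] by blast
  qed
  have mult: "a * p * b \<in> ?I" if "p \<in> ?I" "supp a \<subseteq> lists X" "supp b \<subseteq> lists X" for p a b
  proof -
    obtain z where z: "supp z \<subseteq> mons G deg 1" "D z = emb p" using \<open>p \<in> ?I\<close> by blast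
    have "supp (emb a * z) \<subseteq> mons G deg 1"
      by (rule supp_mult_mons[OF supp_emb[OF that(2)] z(1)]) simp
    then have "supp (emb a * z * emb b) \<subseteq> mons G deg 1"
      by (rule supp_mult_mons[OF _ supp_emb[OF that(3)]]) simp
    moreover have "D (emb a * z * emb b) = emb (a * p * b)"
      using derivation_context[OF D_derivation supp_emb[OF that(2)] supp_emb[OF that(3)] z(1)] z(2)
      by (simp add: emb_mult)
    moreover have "supp (a * p * b) \<subseteq> lists X"
      using that by (intro supp_mult_lists) auto
    ultimately show ?thesis by blast
  qed
  have one: "supp (1 :: 'x list \<Rightarrow>\<^sub>0 'k) \<subseteq> lists X" by (simp add: zero_list_def)
  have "ideal ?I (free_alg X)"
  proof (rule idealI)
    show "subgroup ?I (add_monoid (free_alg X))"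
    proof (rule free_alg.add.subgroupI)
      fix p assume p: "p \<in> ?I"
      \<comment> \<open>Negation is multiplication by the constant minus one.\<close>
      have "scale (-1) 1 * p * 1 \<in> ?I"
        using one supp_scale_subset[OF one, of "-1"] by (intro mult[OF p])
      then show "\<ominus>\<^bsub>free_alg X\<^esub> p \<in> ?I"
        using p by (subst uminus_free_alg) (simp_all add: scale_mult)
    next
      show "?I \<noteq> {}" using zero by blast
    qed (use add in auto)
  next
    fix p a :: "'x list \<Rightarrow>\<^sub>0 'k" assume "p \<in> ?I" "a \<in> carrier (free_alg X)"
    then show "a \<otimes>\<^bsub>free_alg X\<^esub> p \<in> ?I" "p \<otimes>\<^bsub>free_alg X\<^esub> a \<in> ?I"
      using mult[of p a 1] mult[of p 1 a] one by simp_all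
  qed (rule ring_free_alg)
  moreover have "relators W f \<subseteq> ?I"
  proof
    fix p assume p: "p \<in> relators W f"
    then obtain w where w: "w \<in> W" "p = mono_of w - f w" unfolding relators_def by blast
    then have "D (mono_of [\<iota> (Rel w)]) = emb p" "supp (mono_of [\<iota> (Rel w)] :: 'g list \<Rightarrow>\<^sub>0 'k) \<subseteq> mons G deg 1"
      by (simp_all add: D_Rel \<iota>_Rel)
    then show "p \<in> ?I" using relators_carrier p unfolding free_alg_simps by blast
  qed
  ultimately have "relator_ideal \<subseteq> ?I" by (rule free_alg.genideal_minimal)
  then show ?thesis using assms by blast
qed

text \<open>An element of the ideal has the form \<open>D z\<close>; an irreducible one is shown to
  vanish by induction on the finite set of grades occurring in \<open>z\<close>.\<close>

lemma convergent_if_square_zero: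
  assumes lower: "\<And>g. g \<in> G \<Longrightarrow> deg g = 2 \<Longrightarrow> supp (F (mono_of [g])) \<subseteq> {n. word n \<prec> wt g}"
    and square: "\<And>g. g \<in> G \<Longrightarrow> deg g = 2 \<Longrightarrow> D (D (mono_of [g])) = 0"
  shows "convergent X W f"
proof -
  have gen_cases: "deg g = 0 \<or> deg g = 1 \<or> deg g = 2" if "m \<in> mons G deg 2" "g \<in> set m" for m g
  proof -
    have "g \<in> G" "deg g \<le> 2" using that deg_le_sum[of m g] by auto
    then show ?thesis using deg_nonneg[of g] by linarith
  qed
  \<comment> \<open>A word of degree two has letters of degree at most two, and on letters of degree
    zero or one the square vanishes because there is nothing in negative degree.\<close>
  have square_mono: "D (D (mono_of m)) = 0" if m: "m \<in> mons G deg 2" for m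
  proof (rule derivation_square_zero[OF D_derivation])
    show "m \<in> lists G" using m by simp
    fix g assume g: "g \<in> set m"
    then have "g \<in> G" using m by auto
    have D_g: "supp (D (mono_of [g])) \<subseteq> mons G deg (deg g - 1)"
      using \<open>g \<in> G\<close> by (intro derivation_mons[OF D_derivation, of _ "deg g"]) auto
    consider "deg g = 0" | "deg g = 1" | "deg g = 2" using gen_cases[OF m g] by blast
    then show "D (D (mono_of [g])) = 0"
    proof cases
      case 1
      then have "D (mono_of [g]) = 0"
        using \<open>g \<in> G\<close> by (intro derivation_mons_zero[OF D_derivation]) auto
      then show ?thesis by (simp add: derivation_zero[OF D_derivation])
    next
      case 2
      then show ?thesis using D_g by (intro derivation_mons_zero[OF D_derivation]) simp
    qed (use square \<open>g \<in> G\<close> in blast)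
  qed
  have D_square: "D (D y) = 0" if "supp y \<subseteq> mons G deg 2" for y
    using that
  proof (induction y rule: linear_induct)
    case zero
    show ?case by (simp add: derivation_zero[OF D_derivation])
  next
    case (add p q)
    have "supp (D p) \<subseteq> mons G deg 1" "supp (D q) \<subseteq> mons G deg 1"
      by (rule derivation_mons[OF D_derivation], fact, simp)+
    then show ?case using add by (simp add: D_add del: mem_Collect_eq)
  next
    case (scale c m)
    have "supp (mono_of m :: 'g list \<Rightarrow>\<^sub>0 'k) \<subseteq> mons G deg 2" using scale by simp
    moreover have "supp (D (mono_of m)) \<subseteq> mons G deg 1"
      by (rule derivation_mons[OF D_derivation calculation]) simp
    ultimately show ?case using square_mono[OF scale] by (simp add: D_scale del: mem_Collect_eq)
  qed
  have zero: "g = 0" if g: "irreducible_elt X W f g" "supp z \<subseteq> mons G deg 1" "D z = emb g" for g z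
  proof -
    have g_lists: "supp g \<subseteq> lists X" using g(1) by (simp add: irreducible_elt_iff)
    have claim: "\<forall>z. word ` supp z = A \<and> supp z \<subseteq> mons G deg 1 \<and> D z = emb g \<longrightarrow> g = 0"
      if "finite A" for A
      using wf_lt \<open>finite A\<close>
    proof (induction A rule: finite_set_replace_induct)
      case (step A)
      show ?case
      proof (intro allI impI, elim conjE)
        fix z assume A: "word ` supp z = A" and z: "supp z \<subseteq> mons G deg 1" and Dz: "D z = emb g"
        have z_lists: "supp z \<subseteq> lists G" using z by auto
        show "g = 0"
        proof (cases "A = {}")
          case True
          then have "emb g = 0" using A Dz by (simp add: derivation_zero[OF D_derivation])
          then show ?thesis using proj_emb[OF g_lists] by (simp add: proj_zero)
        next
          case False
          have "transp_on A (\<prec>)" by (intro transp_onI) (rule rw_trans)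
          moreover have "asymp_on A (\<prec>)"
            using irrefl_lt rw_trans[of X W f] by (intro asymp_onI) blast
          \<comment> \<open>For a maximal grade \<open>u\<close> of \<open>z\<close>, the part of
            \<open>D z\<close> of grade \<open>u\<close> comes from \<open>d\<close> alone, as
            \<open>F\<close> strictly lowers grades.\<close>
          ultimately obtain u where u: "u \<in> A" "\<And>v. v \<in> A \<Longrightarrow> \<not> u \<prec> v"
            using Finite_Set.bex_max_element[OF \<open>finite A\<close> _ _ False] irrefl_lt by metis
          have zu: "supp (part u z) \<subseteq> mons G deg 1" using z by (auto simp: supp_part)
          have "d (part u z) = 0"
          proof (rule ccontr)
            assume "d (part u z) \<noteq> 0"
            then obtain m where m: "m \<in> supp (d (part u z))"
              by (metis all_not_in_conv keys_eq_empty)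
            then have m_u: "word m = u" "m \<in> supp (d z)"
              by (simp_all add: d_part[OF z_lists] supp_part)
            have "m \<notin> supp (F z)"
              using F_lowers_mons[OF z, of m] u(2) A m_u(1) by auto
            then have "m \<in> supp (D z)"
              using m_u(2) by (simp add: D_def in_keys_iff lookup_add)
            then obtain v where "v \<in> supp g" "m = map (\<lambda>x. \<iota> (Var x)) v"
              using Dz supp_rename_gens[of "\<lambda>x. \<iota> (Var x)" g] unfolding emb_def by auto
            \<comment> \<open>The contradiction: \<open>u\<close> is a word of the irreducible
              \<open>g\<close>, yet as the grade of a degree one monomial it is reducible.\<close>
            then have "u \<in> supp g"
              using word_emb[of v] m_u(1) subsetD[OF g_lists, of v] by metis
            moreover have "reducible_word X W u"
              using u(1) A z mons_one by blast
            ultimately show False using g(1) by (simp add: irreducible_elt_iff)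
          qed
          then obtain y' where y': "supp y' \<subseteq> mons G deg 2" "d y' = part u z"
            using exact_degree_one[OF zu] by blast
          \<comment> \<open>Only the component of grade \<open>u\<close> of the bounding element is
            kept, so that \<open>F\<close> sends it strictly below \<open>u\<close>.\<close>
          define y where "y = part u y'"
          have y: "supp y \<subseteq> mons G deg 2" "supp y \<subseteq> {m. word m = u}"
            using y'(1) by (auto simp: y_def supp_part)
          have "supp y' \<subseteq> lists G" using y'(1) by auto
          then have d_y: "d y = part u z"
            unfolding y_def by (simp add: d_part y'(2)) (rule part_eq, auto simp: supp_part)
          have Dy: "supp (D y) \<subseteq> mons G deg 1"
            by (rule derivation_mons[OF D_derivation y(1)]) simp
          let ?z = "z - D y"
          have "supp ?z \<subseteq> mons G deg 1" using z Dy by (rule supp_diff_subset)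
          moreover have "D ?z = emb g" using D_diff[OF z Dy] D_square[OF y(1)] Dz by simp
          moreover have "word ` supp ?z \<subseteq> A - {u} \<union> {v. v \<prec> u}"
          proof (rule image_subsetI)
            fix m assume m: "m \<in> supp ?z"
            \<comment> \<open>Subtracting \<open>D y\<close> cancels the component of grade
              \<open>u\<close> and introduces nothing but \<open>- F y\<close>.\<close>
            have eq: "?z = (z - part u z) - F y" by (simp add: D_def d_y)
            show "word m \<in> A - {u} \<union> {v. v \<prec> u}"
            proof (cases "m \<in> supp (F y)")
              case True
              then have "\<exists>n\<in>supp y. word m \<prec> word n"
                by (rule F_lowers_mons[OF y(1)]) (intro lower; linarith)
              then show ?thesis using y(2) by auto
            next
              case False
              then have "m \<in> supp (z - part u z)"
                using m unfolding eq by (simp add: in_keys_iff lookup_minus)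
              then have "m \<in> supp z" "word m \<noteq> u"
                by (auto simp: in_keys_iff lookup_minus lookup_part split: if_splits)
              then show ?thesis using A by auto
            qed
          qed
          ultimately show ?thesis
            using step(2)[OF u(1) finite_imageI[OF finite_keys], rule_format, of word ?z ?z]
            by (simp only: simp_thms)
        qed
      qed
    qed
    show ?thesis
      using claim[of "word ` supp z", rule_format, of z] g(2,3)
      by (simp only: simp_thms finite_imageI finite_keys)
  qed
  show ?thesis
    unfolding convergent_iff
  proof (intro ballI impI)
    fix g assume "g \<in> relator_ideal" and g: "irreducible_elt X W f g"
    then obtain z where "supp z \<subseteq> mons G deg 1" "D z = emb g"
      using relator_ideal_boundary by blast
    then show "g = 0" by (rule zero[OF g])
  qed
qed

text \<open>Here \<open>D y = F y\<close> involves only grades below \<open>u\<close> and projects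
  into the ideal of relations, so by convergence it reduces to \<open>0\<close>. Each reduction step
  at \<open>a @ w @ b\<close> lifts to a multiple of \<open>a e\<^sub>w b\<close>, again of grade
  below \<open>u\<close>; these multiples add up to \<open>z\<close>.\<close>

lemma lower_boundary:
  assumes conv: "convergent X W f"
    and y: "supp y \<subseteq> mons G deg 1" "supp y \<subseteq> {m. word m = u}" "d y = 0"
  shows "\<exists>z. supp z \<subseteq> mons G deg 1 \<and> supp z \<subseteq> {m. word m \<prec> u} \<and> D z = D y"
proof -
  let ?Q = "\<lambda>q. \<exists>z. supp z \<subseteq> mons G deg 1 \<and> supp z \<subseteq> {m. word m \<prec> u} \<and> D z = emb q"
  define p where "p = proj (D y)"
  have Dy: "supp (D y) \<subseteq> mons G deg 0"
    by (rule derivation_mons[OF D_derivation y(1)]) simp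
  have "D y = F y" using y(3) by (simp add: D_def)
  have "word m \<prec> u" if m: "m \<in> supp (D y)" for m
  proof -
    have "\<exists>n\<in>supp y. word m \<prec> word n"
      by (rule F_lowers_mons[OF y(1) m[unfolded \<open>D y = F y\<close>]]) linarith
    then show ?thesis using y(2) by auto
  qed
  moreover have "supp p \<subseteq> word ` supp (D y)"
    unfolding p_def using Dy by (intro supp_proj) auto
  moreover have "word m \<in> lists X" if "m \<in> supp (D y)" for m
    using Dy that by (intro word_lists) auto
  ultimately have p: "supp p \<subseteq> lists X" "supp p \<subseteq> {v. v \<prec> u}" by blast+
  have "\<exists>h. irreducible_elt X W f h \<and> ?Q (p - h)"
  proof (rule reduce_to_irreducible[OF p])
    show "v' \<in> {v. v \<prec> u}" if "v \<in> {v. v \<prec> u}" "v' \<prec> v" for v v'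
      using that by (auto intro: rw_trans)
    show "?Q 0"
      by (rule exI[of _ 0]) (simp add: derivation_zero[OF D_derivation] emb_zero)
  next
    fix q c a w b
    assume "?Q q" and awb: "a \<in> lists X" "w \<in> W" "b \<in> lists X" "a @ w @ b \<in> {v. v \<prec> u}"
    then obtain z where z: "supp z \<subseteq> mons G deg 1" "supp z \<subseteq> {m. word m \<prec> u}" "D z = emb q" by blast
    let ?e = "emb (mono_of a) * mono_of [\<iota> (Rel w)] * emb (mono_of b)"
    let ?m = "map (\<lambda>x. \<iota> (Var x)) a @ [\<iota> (Rel w)] @ map (\<lambda>x. \<iota> (Var x)) b"
    have e: "?e = mono_of ?m"
      by (simp add: emb_mono_of mono_of_append mult.assoc mono_of_Cons[of _ "map _ b"])
    have m: "?m \<in> mons G deg 1" "word ?m = a @ w @ b"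
      using emb_mons[OF awb(1)] emb_mons[OF awb(3)] awb(2) word_emb[OF awb(1)] word_emb[OF awb(3)]
      by (auto simp: \<iota>_Rel simp del: map_map)
    have supp_e: "supp (scale c ?e) \<subseteq> mons G deg 1" "supp (scale c ?e) \<subseteq> {m. word m \<prec> u}"
      unfolding e using m awb(4) by (auto intro!: supp_scale_subset simp del: map_map)
    have "D ?e = emb (mono_of a) * D (mono_of [\<iota> (Rel w)]) * emb (mono_of b)"
      using awb(1-3)
      by (intro derivation_context[OF D_derivation, where i = 1] supp_emb) (auto simp: \<iota>_Rel)
    then have "D ?e = emb (mono_of a * (mono_of w - f w) * mono_of b)"
      by (simp add: D_Rel[OF awb(2)] emb_mult)
    moreover have "supp ?e \<subseteq> mons G deg 1" unfolding e using m(1) by simp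
    ultimately have "D (z + scale c ?e) = emb (q + scale c (mono_of a * (mono_of w - f w) * mono_of b))"
      using D_add[OF z(1) supp_e(1)] D_scale[of ?e 1 c] z(3) by (simp only: emb_add emb_scale)
    then show "?Q (q + scale c (mono_of a * (mono_of w - f w) * mono_of b))"
      using supp_add_subset[OF z(1) supp_e(1)] supp_add_subset[OF z(2) supp_e(2)]
      by (intro exI[of _ "z + scale c ?e"] conjI)
  qed
  then obtain h z where h: "irreducible_elt X W f h" and
    z: "supp z \<subseteq> mons G deg 1" "supp z \<subseteq> {m. word m \<prec> u}" "D z = emb (p - h)" by blast
  have "supp h \<subseteq> lists X" using h by (simp add: irreducible_elt_iff)
  with p(1) have "supp (p - h) \<subseteq> lists X" by (rule supp_diff_subset)
  then have "p - h \<in> relator_ideal"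
    using proj_boundary[OF z(1)] z(3) by (simp add: proj_emb)
  moreover have "p \<in> relator_ideal" unfolding p_def by (rule proj_boundary[OF y(1)])
  \<comment> \<open>This combination is the irreducible remainder \<open>h\<close>, which
    convergence forces to be zero.\<close>
  ultimately have "p + scale (-1) (p - h) \<in> relator_ideal"
    by (intro relator_ideal_add relator_ideal_scale)
  then have "h \<in> relator_ideal" by simp
  then have "h = 0" using conv h unfolding convergent_iff by blast
  then have "D z = D y" using z(3) Dy by (simp add: p_def emb_proj)
  with z show ?thesis by blast
qed

end

section \<open>Both implications, for conditions stated on generators\<close>

context word_hom_extension
begin

text \<open>The conditions of the theorem tested on basis elements. The equation
  \<open>(d + F)\<^sup>2 = 0\<close> is recorded in degree two, since in degrees zero and one it
  holds for degree reasons.\<close>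

definition perturbation :: "(('g list \<Rightarrow>\<^sub>0 'k) \<Rightarrow> ('g list \<Rightarrow>\<^sub>0 'k)) \<Rightarrow> bool" where
  "perturbation F \<longleftrightarrow> graded_derivation T (-1) F \<and>
     (\<forall>w\<in>W. F (mono_of [\<iota> (Rel w)]) = - emb (f w)) \<and>
     (\<forall>g\<in>G. deg g = 2 \<longrightarrow> supp (F (mono_of [g])) \<subseteq> {n. word n \<prec> wt g} \<and>
        d (d (mono_of [g]) + F (mono_of [g])) + F (d (mono_of [g]) + F (mono_of [g])) = 0)"

lemma convergent_if_perturbation:
  assumes "perturbation F"
  shows "convergent X W f"
proof -
  interpret twisted_extension X W f G deg wt d \<iota> \<phi> F
    using assms by unfold_locales (simp_all add: perturbation_def)
  show ?thesis
    using assms by (intro convergent_if_square_zero) (simp_all add: perturbation_def D_def)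
qed

text \<open>The provisional \<open>F1\<close> has the required values in degree one and is zero on
  all other generators. Applying \<open>lower_boundary\<close> to \<open>d v\<close> for each
  generator \<open>v\<close> of degree two gives a correction of smaller grade, whose negative
  becomes the value of \<open>F\<close> at \<open>v\<close>.\<close>

lemma perturbation_if_convergent:
  assumes conv: "convergent X W f"
  shows "\<exists>F. perturbation F"
proof -
  \<comment> \<open>For \<open>g = e\<^sub>w\<close> the grade \<open>wt g\<close> recovers the word
    \<open>w\<close>.\<close>
  define \<delta>1 where "\<delta>1 g = (if deg g = 1 then - emb (f (wt g)) else 0)" for g
  define F1 where "F1 = derivation_ext deg (-1) \<delta>1"
  have \<delta>1: "supp (\<delta>1 g) \<subseteq> mons G deg (deg g + - 1)" if "g \<in> G" for g
  proof (cases "deg g = 1")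
    case True
    then obtain w where "w \<in> W" "g = \<iota> (Rel w)" using deg_one_gen \<open>g \<in> G\<close> by blast
    then show ?thesis
      using True supp_emb[OF supp_f[of w]] by (simp add: \<delta>1_def \<iota>_Rel)
  qed (simp add: \<delta>1_def)
  interpret F1: twisted_extension X W f G deg wt d \<iota> \<phi> F1
  proof unfold_locales
    show "graded_derivation T (-1) F1"
      unfolding F1_def by (rule graded_derivation_ext[OF \<delta>1])
  qed (simp add: F1_def derivation_ext_gen \<delta>1_def \<iota>_Rel)
  have "\<exists>z. supp z \<subseteq> mons G deg 1 \<and> supp z \<subseteq> {m. word m \<prec> wt g} \<and> F1.D z = F1.D (d (mono_of [g]))"
    if g: "g \<in> G" "deg g = 2" for g
  proof (rule F1.lower_boundary[OF conv])
    show "supp (d (mono_of [g])) \<subseteq> mons G deg 1"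
      using g by (intro derivation_mons[OF d_derivation, of _ 2]) auto
    show "supp (d (mono_of [g])) \<subseteq> {m. word m = wt g}"
      using d_word[of "[g]"] g by auto
    show "d (d (mono_of [g])) = 0" using g by (intro d_square) simp
  qed
  then have "\<forall>g\<in>{g \<in> G. deg g = 2}. \<exists>z. supp z \<subseteq> mons G deg 1 \<and> supp z \<subseteq> {m. word m \<prec> wt g} \<and>
      F1.D z = F1.D (d (mono_of [g]))"
    by simp
  from bchoice[OF this] obtain z where "\<forall>g\<in>{g \<in> G. deg g = 2}. supp (z g) \<subseteq> mons G deg 1 \<and>
      supp (z g) \<subseteq> {m. word m \<prec> wt g} \<and> F1.D (z g) = F1.D (d (mono_of [g]))" ..
  then have z: "supp (z g) \<subseteq> mons G deg 1" "supp (z g) \<subseteq> {m. word m \<prec> wt g}"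
    "F1.D (z g) = F1.D (d (mono_of [g]))" if "g \<in> G" "deg g = 2" for g
    using that by blast+
  define \<delta> where "\<delta> g = (if deg g = 2 then - z g else \<delta>1 g)" for g
  define F where "F = derivation_ext deg (-1) \<delta>"
  have \<delta>_mons: "supp (\<delta> g) \<subseteq> mons G deg (deg g + - 1)" if "g \<in> G" for g
    using \<delta>1[OF that] z(1)[OF that] by (cases "deg g = 2") (simp_all add: \<delta>_def del: mem_Collect_eq)
  have F: "graded_derivation T (-1) F"
    unfolding F_def by (rule graded_derivation_ext[OF \<delta>_mons])
  have F_eq: "F p = F1 p" if p: "supp p \<subseteq> mons G deg 1" for p
    unfolding F_def F1_def
  proof (rule derivation_ext_cong)
    fix m g assume "m \<in> supp p" "g \<in> set m"
    then have "m \<in> mons G deg 1" using p by blast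
    then have "deg g \<le> 1" using deg_le_sum[of m g] \<open>g \<in> set m\<close> by simp
    then show "\<delta> g = \<delta>1 g" by (simp add: \<delta>_def)
  qed
  have "supp (F (mono_of [g])) \<subseteq> {n. word n \<prec> wt g}"
    "d (d (mono_of [g]) + F (mono_of [g])) + F (d (mono_of [g]) + F (mono_of [g])) = 0"
    if g: "g \<in> G" "deg g = 2" for g
  proof -
    have F_g: "F (mono_of [g]) = - z g"
      by (simp add: F_def derivation_ext_gen \<delta>_def g)
    then show "supp (F (mono_of [g])) \<subseteq> {n. word n \<prec> wt g}"
      using z(2)[OF g] by simp
    have dg: "supp (d (mono_of [g])) \<subseteq> mons G deg 1"
      using g by (intro derivation_mons[OF d_derivation, of _ 2]) auto
    then have "supp (d (mono_of [g]) - z g) \<subseteq> mons G deg 1"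
      using z(1)[OF g] by (rule supp_diff_subset)
    \<comment> \<open>The inner sum has degree one, where \<open>F\<close> and \<open>F1\<close>
      agree.\<close>
    then have "d (d (mono_of [g]) + F (mono_of [g])) + F (d (mono_of [g]) + F (mono_of [g]))
        = F1.D (d (mono_of [g]) - z g)"
      by (simp only: F_g F_eq F1.D_def add_uminus_conv_diff)
    also have "\<dots> = 0"
      using F1.D_diff[OF dg z(1)[OF g]] z(3)[OF g] by simp
    finally show "d (d (mono_of [g]) + F (mono_of [g])) + F (d (mono_of [g]) + F (mono_of [g])) = 0" .
  qed
  moreover have "F (mono_of [\<iota> (Rel w)]) = - emb (f w)" if "w \<in> W" for w
    using that by (simp add: F_def derivation_ext_gen \<delta>_def \<delta>1_def \<iota>_Rel)
  ultimately show ?thesis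
    unfolding perturbation_def using F by blast
qed

section \<open>From conditions on subspaces to conditions on generators\<close>

lemma minus_T: "supp p \<subseteq> lists G \<Longrightarrow> supp q \<subseteq> lists G \<Longrightarrow> p \<ominus>\<^bsub>T\<^esub> q = p - q"
proof -
  assume q: "supp q \<subseteq> lists G"
  then have "\<ominus>\<^bsub>T\<^esub> q = - q" by (intro T.minus_equality) auto
  then show ?thesis by (simp add: a_minus_def)
qed

lemma submodule_supp: "submodule {p :: 'g list \<Rightarrow>\<^sub>0 'k. supp p \<subseteq> lists G \<and> supp p \<subseteq> K} scalars T"
proof (rule T.submoduleI)
  fix p :: "'g list \<Rightarrow>\<^sub>0 'k" assume p: "p \<in> {p. supp p \<subseteq> lists G \<and> supp p \<subseteq> K}"
  then have "\<ominus>\<^bsub>T\<^esub> p = - p" by (intro T.minus_equality) auto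
  with p show "\<ominus>\<^bsub>T\<^esub> p \<in> {p. supp p \<subseteq> lists G \<and> supp p \<subseteq> K}" by simp
next
  fix p q :: "'g list \<Rightarrow>\<^sub>0 'k"
  assume "p \<in> {p. supp p \<subseteq> lists G \<and> supp p \<subseteq> K}" "q \<in> {p. supp p \<subseteq> lists G \<and> supp p \<subseteq> K}"
  then show "p \<oplus>\<^bsub>T\<^esub> q \<in> {p. supp p \<subseteq> lists G \<and> supp p \<subseteq> K}"
    by (simp add: supp_add_subset)
next
  fix c :: 'k and p :: "'g list \<Rightarrow>\<^sub>0 'k"
  assume "p \<in> {p. supp p \<subseteq> lists G \<and> supp p \<subseteq> K}"
  then show "c \<odot>\<^bsub>T\<^esub> p \<in> {p. supp p \<subseteq> lists G \<and> supp p \<subseteq> K}"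
    by (simp add: supp_scale_subset)
qed auto

text \<open>The right side is a submodule containing all the pieces; conversely, each of its
  monomials lies in the piece of its own grade.\<close>

lemma lin_span_lower:
  "lin_span T (\<Union>v\<in>{v \<in> lists X. v \<prec> u}. word_part G wt v) = {p. supp p \<subseteq> lists G \<and> supp p \<subseteq> {n. word n \<prec> u}}"
    (is "lin_span T ?S = ?U")
proof
  have "?S \<subseteq> ?U" by (auto simp: word_part_def)
  then show "lin_span T ?S \<subseteq> ?U"
    unfolding lin_span_def using submodule_supp by (intro Inter_lower) blast
  show "?U \<subseteq> lin_span T ?S"
    unfolding lin_span_def
  proof (intro subsetI InterI, elim CollectE conjE)
    fix p :: "'g list \<Rightarrow>\<^sub>0 'k" and U
    assume p: "supp p \<subseteq> lists G" "supp p \<subseteq> {n. word n \<prec> u}"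
      and U: "submodule U scalars T" "?S \<subseteq> U"
    from p have "supp p \<subseteq> {n \<in> lists G. word n \<prec> u}" by blast
    then show "p \<in> U"
    proof (induction p rule: linear_induct)
      case zero
      show ?case using subgroup.one_closed[OF submodule.axioms(1)[OF U(1)]] by simp
    next
      case (add p q)
      then show ?case using T.submoduleE(5)[OF U(1), of p q] by simp
    next
      case (scale c m)
      then have "scale c (mono_of m) \<in> word_part G wt (word m)"
        using supp_scale[of c "mono_of m :: 'g list \<Rightarrow>\<^sub>0 'k"] by (auto simp: word_part_def)
      then show ?case using scale word_lists[of m] U(2) by blast
    qed
  qed
qed

text \<open>Generators are word-homogeneous, and an element of \<open>V\<^sub>2\<close> of grade
  \<open>u\<close> is a combination of generators of grade \<open>u\<close>; linearity of
  \<open>F\<close> does the rest.\<close>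

lemma filtered_on_iff:
  assumes F: "graded_derivation T (-1) F"
  shows "filtered_on X (\<prec>) T (word_part G wt) (gen_space {g \<in> G. deg g = 2}) F \<longleftrightarrow>
    (\<forall>g\<in>G. deg g = 2 \<longrightarrow> supp (F (mono_of [g])) \<subseteq> {n. word n \<prec> wt g})"
  unfolding filtered_on_def lin_span_lower
proof (intro iffI ballI impI)
  fix g assume *: "\<forall>u\<in>lists X. \<forall>v\<in>gen_space {g \<in> G. deg g = 2} \<inter> word_part G wt u.
      F v \<in> {p. supp p \<subseteq> lists G \<and> supp p \<subseteq> {n. word n \<prec> u}}" and g: "g \<in> G" "deg g = 2"
  then have "mono_of [g] \<in> gen_space {g \<in> G. deg g = 2} \<inter> word_part G wt (wt g)"
    by (simp add: gen_space_def word_part_def)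
  with * wt_lists[OF g(1)] show "supp (F (mono_of [g])) \<subseteq> {n. word n \<prec> wt g}" by blast
next
  fix u and v :: "'g list \<Rightarrow>\<^sub>0 'k"
  assume F2: "\<forall>g\<in>G. deg g = 2 \<longrightarrow> supp (F (mono_of [g])) \<subseteq> {n. word n \<prec> wt g}"
    and "v \<in> gen_space {g \<in> G. deg g = 2} \<inter> word_part G wt u"
  then have v: "supp v \<subseteq> (\<lambda>g. [g]) ` {g \<in> G. deg g = 2}" "supp v \<subseteq> lists G"
    "\<And>m. m \<in> supp v \<Longrightarrow> word m = u"
    by (auto simp: gen_space_def word_part_def)
  have "supp (F (mono_of m)) \<subseteq> {n. word n \<prec> u}" if "m \<in> supp v" for m
    using v(1,3) F2 that by fastforce
  then show "F v \<in> {p. supp p \<subseteq> lists G \<and> supp p \<subseteq> {n. word n \<prec> u}}"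
    using derivation_closed[OF F v(2)] supp_derivation[OF F v(2)] by blast
qed

text \<open>Both brackets are anticommutators, as the two degrees have odd product. Since
  \<open>2\<close> is invertible, half of the second bracket is \<open>F (F v)\<close>, and
  \<open>d (d v) = 0\<close> supplies the remaining term of the square.\<close>

lemma maurer_cartan_eq:
  assumes F: "graded_derivation T (-1) F" and v: "supp v \<subseteq> lists G"
    and two: "(2 :: 'k) \<noteq> 0"
  shows "der_bracket T (-1) (-1) d F v \<oplus>\<^bsub>T\<^esub> (1/2) \<odot>\<^bsub>T\<^esub> der_bracket T (-1) (-1) F F v
    = d (d v + F v) + F (d v + F v)"
proof -
  note closed = derivation_closed[OF F] derivation_closed[OF d_derivation]
  have "der_bracket T (-1) (-1) E F v = E (F v) + F (E v)" if "graded_derivation T (-1) E" for E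
    using v closed derivation_closed[OF that]
    by (simp add: der_bracket_def minus_T supp_scale_subset)
  note bracket = this[OF d_derivation] this[OF F]
  have "(1/2 :: 'k) + 1/2 = 1" using two by (simp flip: mult_2)
  then have half: "scale (1/2 :: 'k) (p + p) = p" for p :: "'g list \<Rightarrow>\<^sub>0 'k"
    by (simp add: scale_add flip: scale_add_left)
  show ?thesis
    unfolding bracket quasi_free_simps half
    using v closed d_square[OF v] by (simp add: derivation_add[OF F] derivation_add[OF d_derivation])
qed

text \<open>In degrees zero and one the square of \<open>d + F\<close> lands in negative degree; by
  linearity only the generators of degree two remain to be tested.\<close>

lemma maurer_cartan_iff:
  assumes F: "graded_derivation T (-1) F" and two: "(2 :: 'k) \<noteq> 0"
  shows "(\<forall>v\<in>gen_space {g \<in> G. deg g \<in> {0, 1, 2}}.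
      der_bracket T (-1) (-1) d F v \<oplus>\<^bsub>T\<^esub> (1/2) \<odot>\<^bsub>T\<^esub> der_bracket T (-1) (-1) F F v = \<zero>\<^bsub>T\<^esub>) \<longleftrightarrow>
    (\<forall>g\<in>G. deg g = 2 \<longrightarrow> d (d (mono_of [g]) + F (mono_of [g])) + F (d (mono_of [g]) + F (mono_of [g])) = 0)"
    (is "?L \<longleftrightarrow> ?R")
proof
  assume L: ?L
  show ?R
  proof (intro ballI impI)
    fix g assume g: "g \<in> G" "deg g = 2"
    then have "mono_of [g] \<in> gen_space {g \<in> G. deg g \<in> {0, 1, 2}}"
      and lists: "supp (mono_of [g] :: 'g list \<Rightarrow>\<^sub>0 'k) \<subseteq> lists G"
      by (simp_all add: gen_space_def)
    from bspec[OF L this(1)]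
    show "d (d (mono_of [g]) + F (mono_of [g])) + F (d (mono_of [g]) + F (mono_of [g])) = 0"
      unfolding maurer_cartan_eq[OF F lists two] by simp
  qed
next
  assume R: ?R
  define D where "D p = d p + F p" for p
  have D: "graded_derivation T (-1) D"
    using graded_derivation_add[OF d_derivation F] by (simp add: D_def[abs_def])
  have gen: "D (D (mono_of [g])) = 0" if g: "g \<in> G" "deg g \<in> {0, 1, 2}" for g
  proof (cases "deg g = 2")
    case True
    then show ?thesis using R g by (simp add: D_def)
  next
    case False
    have "supp (D (mono_of [g])) \<subseteq> mons G deg (deg g - 1)"
      using g by (intro derivation_mons[OF D, of _ "deg g"]) auto
    then have "supp (D (D (mono_of [g]))) \<subseteq> mons G deg (deg g - 2)"
      by (rule derivation_mons[OF D]) simp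
    moreover have "mons G deg (deg g - 2) = {}"
      using False g(2) by (intro mons_negative) auto
    ultimately show ?thesis by simp
  qed
  show ?L
  proof
    fix v :: "'g list \<Rightarrow>\<^sub>0 'k" assume v: "v \<in> gen_space {g \<in> G. deg g \<in> {0, 1, 2}}"
    then have "supp v \<subseteq> (\<lambda>g. [g]) ` {g \<in> G. deg g \<in> {0, 1, 2}}" by (simp add: gen_space_def)
    then have "supp v \<subseteq> lists G \<and> D (D v) = 0"
    proof (induction v rule: linear_induct)
      case zero
      show ?case by (simp add: derivation_zero[OF D])
    next
      case (add p q)
      then show ?case
        using derivation_closed[OF D]
        by (simp add: derivation_add[OF D] supp_add_subset)
    next
      case (scale c m)
      then obtain g where g: "g \<in> G" "deg g \<in> {0, 1, 2}" "m = [g]" by blast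
      then have m: "supp (mono_of m :: 'g list \<Rightarrow>\<^sub>0 'k) \<subseteq> lists G" by simp
      show ?case
        using gen[OF g(1,2)] g(3) m derivation_closed[OF D m]
        by (simp add: derivation_scale[OF D] supp_scale_subset del: supp_mono_of)
    qed
    then show "der_bracket T (-1) (-1) d F v \<oplus>\<^bsub>T\<^esub> (1/2) \<odot>\<^bsub>T\<^esub> der_bracket T (-1) (-1) F F v = \<zero>\<^bsub>T\<^esub>"
      using maurer_cartan_eq[OF F _ two, of v] by (simp add: D_def)
  qed
qed

end

theorem theorem5p1:
  fixes X :: "'x set"
    and W :: "'x list set"
    and f :: "'x list \<Rightarrow> ('x list \<Rightarrow>\<^sub>0 'k::field_char_0)"
    and G :: "'g set"
    and deg :: "'g \<Rightarrow> int"
    and wt :: "'g \<Rightarrow> 'x list"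
    and d :: "('g list \<Rightarrow>\<^sub>0 'k) \<Rightarrow> ('g list \<Rightarrow>\<^sub>0 'k)"
    and \<iota> :: "'x sha_gen \<Rightarrow> 'g"
    and \<phi> :: "('g list \<Rightarrow>\<^sub>0 'k) \<Rightarrow> ('x list \<Rightarrow>\<^sub>0 'k) set"
  defines "T \<equiv> quasi_free G deg d"
  assumes "finite X"
    and "rewriting_system X W f"
    and "terminating X W f"
    and "word_hom_acyclic_extension X W G deg wt d \<iota> \<phi>"
    and "finite_type G deg d"
  shows "convergent X W f \<longleftrightarrow>
    (\<exists>F. graded_derivation T (-1) F \<and>
       (\<forall>w\<in>W. F (mono_of [\<iota> (Rel w)]) = - rename_gens (\<iota> \<circ> Var) (f w)) \<and>
       filtered_on X (rw_less X W f) T (word_part G wt) (gen_space {g \<in> G. deg g = 2}) F \<and>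
       (\<forall>v\<in>gen_space {g \<in> G. deg g \<in> {0, 1, 2}}.
          der_bracket T (-1) (-1) d F v \<oplus>\<^bsub>T\<^esub> (1/2) \<odot>\<^bsub>T\<^esub> der_bracket T (-1) (-1) F F v = \<zero>\<^bsub>T\<^esub>))"
proof -
  interpret word_hom_extension X W f G deg wt d \<iota> \<phi>
    by unfold_locales (fact assms)+
  have "emb = rename_gens (\<iota> \<circ> Var)" by (simp add: emb_def comp_def)
  then have eq: "perturbation F \<longleftrightarrow> graded_derivation T (-1) F \<and>
       (\<forall>w\<in>W. F (mono_of [\<iota> (Rel w)]) = - rename_gens (\<iota> \<circ> Var) (f w)) \<and>
       filtered_on X (rw_less X W f) T (word_part G wt) (gen_space {g \<in> G. deg g = 2}) F \<and>
       (\<forall>v\<in>gen_space {g \<in> G. deg g \<in> {0, 1, 2}}.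
          der_bracket T (-1) (-1) d F v \<oplus>\<^bsub>T\<^esub> (1/2) \<odot>\<^bsub>T\<^esub> der_bracket T (-1) (-1) F F v = \<zero>\<^bsub>T\<^esub>)" for F
    unfolding T_def perturbation_def
    \<comment> \<open>The two translations presuppose that \<open>F\<close> is a derivation;
      otherwise both sides are false. Characteristic zero supplies
      \<open>2 \<noteq> 0\<close>.\<close>
    by (cases "graded_derivation (quasi_free G deg d) (-1) F")
      (simp_all only: filtered_on_iff maurer_cartan_iff zero_neq_numeral[symmetric] not_False_eq_True
        simp_thms, blast)
  have "convergent X W f \<longleftrightarrow> (\<exists>F. perturbation F)"
    using convergent_if_perturbation perturbation_if_convergent by blast
  then show ?thesis by (simp only: eq)
qed

end
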